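(* Fix physical parameters $\rho_l>0$, $\kappa\ge 0$, $\sigma>0$, $T_\infty>0$, $p_{\infty,*}>0$, $R_g>0$, $c_v>0$, and set $\gamma=1+R_g/c_v$. Let $M>0$. Then there exists a solution $(\Omega_*,\mathbf v_{l,*},p_{l,*},\rho_{g,*},\mathbf v_{g,*},p_{g,*})$ of the steady-state system below, satisfying the far-field conditions and the mass constraint $\int_{\Omega_*}\rho_{g,*}\,dx=M$, such that $\mathbf v_{l,*}\not\equiv\mathbf 0$ and $\Omega_*=B_{R_*}$ is a ball of some radius $R_*=R_*[M]>0$ (depending on $M$). The steady-state system: the unknowns are a bounded open region $\Omega_*\subset\mathbb R^3$ (the bubble), a liquid velocity $\mathbf v_{l,*}$ and liquid pressure $p_{l,*}$ on $\mathbb R^3\setminus\Omega_*$, a gas density $\rho_{g,*}>0$ and gas velocity $\mathbf v_{g,*}$ on $\Omega_*$, and a constant gas pressure $p_{g,*}$, satisfying \begin{itemize} \item in $\mathbb R^3\setminus\Omega_*$: $\ (\mathbf v_{l,*}\cdot\nabla)\mathbf v_{l,*}=-\frac{1}{\rho_l}\nabla p_{l,*}$ and $\nabla\cdot\mathbf v_{l,*}=0$; \item in $\Omega_*$: $\ \nabla\cdot(\rho_{g,*}\mathbf v_{g,*})=0$, $p_{g,*}$ is constant, and $0=\frac{\kappa}{\gamma c_v}\Delta\log\rho_{g,*}-\frac{\kappa}{\gamma c_v}\frac{|\nabla\rho_{g,*}|^2}{\rho_{g,*}^2}-\mathbf v_{g,*}\cdot\nabla\rho_{g,*}$; \item on $\partial\Omega_*$: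 $\ \mathbf v_{l,*}\cdot\hat{\mathbf n}=\mathbf v_{g,*}\cdot\hat{\mathbf n}=0$, $\ p_{g,*}-p_{l,*}=\sigma\,\nabla_S\cdot\hat{\mathbf n}$, $\ p_{g,*}=R_gT_\infty\rho_{g,*}$; \end{itemize} with far-field conditions $\mathbf v_{l,*}(x)=O(|x|^{-2})$, $\nabla\mathbf v_{l,*}(x)\to 0$ and $p_{l,*}(x)\to p_{\infty,*}$ as $|x|\to\infty$.
   Context: $\hat{\mathbf n}$ denotes the unit outward normal to $\Omega_*$ on $\partial\Omega_*$ and $\nabla_S\cdot\hat{\mathbf n}$ its surface divergence, i.e. twice the mean curvature of $\partial\Omega_*$ (so that for a sphere of radius $R$ it equals $2/R$). Physically: $\rho_l$ is the liquid density, $\kappa$ the gas thermal conductivity, $\sigma$ the surface tension, $T_\infty$ the far-field temperature, $p_{\infty,*}$ the far-field pressure, $R_g$ the specific gas constant, $c_v$ the heat capacity at constant volume, and $\gamma$ the adiabatic constant. *)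

theory Defs
  imports "HOL-Analysis.Analysis"
begin

text \<open>Classical differential operators on functions of x in R^3 (type real^3).
  pd f i x is the partial derivative of f in direction e_i at x (Frechet derivative
  applied to the i-th unit vector); meaningful where f is differentiable.\<close>

definition pd :: "(real^3 \<Rightarrow> 'a::real_normed_vector) \<Rightarrow> 3 \<Rightarrow> real^3 \<Rightarrow> 'a" where
  "pd f i x = frechet_derivative f (at x) (axis i 1)"

definition grad :: "(real^3 \<Rightarrow> real) \<Rightarrow> real^3 \<Rightarrow> real^3" where
  "grad f x = (\<chi> i. pd f i x)"

definition divg :: "(real^3 \<Rightarrow> real^3) \<Rightarrow> real^3 \<Rightarrow> real" where
  "divg v x = (\<Sum>i\<in>UNIV. pd v i x $ i)"

definition lap :: "(real^3 \<Rightarrow> real) \<Rightarrow> real^3 \<Rightarrow> real" where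
  "lap f x = (\<Sum>i\<in>UNIV. pd (pd f i) i x)"

definition conv :: "(real^3 \<Rightarrow> real^3) \<Rightarrow> (real^3 \<Rightarrow> real^3) \<Rightarrow> real^3 \<Rightarrow> real^3" where
  "conv v w x = (\<Sum>i\<in>UNIV. (v x $ i) *\<^sub>R pd w i x)"

definition C1_on :: "(real^3) set \<Rightarrow> (real^3 \<Rightarrow> 'a::real_normed_vector) \<Rightarrow> bool" where
  "C1_on S f \<longleftrightarrow> (\<forall>x\<in>S. f differentiable (at x)) \<and> (\<forall>i. continuous_on S (pd f i))"

definition C2_on :: "(real^3) set \<Rightarrow> (real^3 \<Rightarrow> 'a::real_normed_vector) \<Rightarrow> bool" where
  "C2_on S f \<longleftrightarrow> C1_on S f \<and> (\<forall>i. C1_on S (pd f i))"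

end

theory Submission
  imports Defs
begin

text \<open>
  The gas is at rest with constant density; a cubic equation then fixes the radius. The liquid is at
  rest except inside a solid torus away from the bubble, which carries a compactly supported steady
  Euler flow in the manner of Gavrilov, so that it does not disturb the conditions on the sphere.

  Write \<open>t = r\<^sup>2\<close> in cylindrical coordinates. One needs a function \<open>u(t, z)\<close> with closed level curves
  such that \<open>\<bar>\<nabla>u\<bar>\<^sup>2 = a(u) t - b(u)\<close> and \<open>u\<^sub>t\<close> is affine in \<open>t\<close> on each level curve. The velocity with
  radial, azimuthal and axial components \<open>\<omega>(u)/r\<close> times \<open>-u\<^sub>z\<close>, \<open>\<surd>b(u)\<close>, \<open>u\<^sub>r\<close> then solves the Euler
  equations with a pressure that depends on \<open>u\<close> only, for every profile \<open>\<omega>\<close>, and a bump function \<open>\<omega>\<close>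
  localises it. With \<open>u\<^sub>z\<close> proportional to \<open>\<xi>\<close>, where \<open>\<xi>\<^sup>2 = 4w\<^sup>3 - 3w - u\<close>, and \<open>t = J(u)\<^sup>2(W(u) - w)\<close>, the
  compatibility conditions become a Riccati equation for \<open>W\<close>, linearised by the Legendre equation
  \<open>((1 - u\<^sup>2)J')' = (5/36)J\<close>; its solution regular at \<open>u = 1\<close> gives an explicit closed form
  \<open>dz\<close> in the coordinates \<open>(\<xi>, w)\<close>, and the inverse function theorem recovers \<open>u(t, z)\<close> near the
  circle \<open>t = 3/2\<close>, \<open>z = 0\<close>.
\<close>

subsection \<open>A Legendre function and its companions\<close>

text \<open>Since \<open>n^2 + n + 5/36 = (n + 1/6)(n + 5/6)\<close>, these are the coefficients of
  the hypergeometric series \<open>2F1(1/6, 5/6; 1; x)\<close>. At \<open>x = (1 - u) / 2\<close> it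
  is the Legendre function of degree \<open>-1/6\<close>.\<close>

fun legendre_coeff :: "nat \<Rightarrow> real" where
  "legendre_coeff 0 = 1"
| "legendre_coeff (Suc n) = (real n ^ 2 + real n + 5 / 36) / (real n + 1) ^ 2 * legendre_coeff n"

text \<open>The ratio of consecutive coefficients lies in (0, 1], because \<open>(n + 1)^2\<close>
  exceeds its numerator by \<open>n + 31/36\<close>. Boundedness gives convergence for
  \<open>\<bar>x\<bar> < 1\<close> by comparison with a geometric series.\<close>

lemma legendre_coeff_bounds: "0 < legendre_coeff n \<and> legendre_coeff n \<le> 1"
proof (induction n)
  case (Suc n)
  have "(real n ^ 2 + real n + 5 / 36) / (real n + 1) ^ 2 \<le> 1"
    by (simp add: divide_simps power2_eq_square) (simp add: algebra_simps)
  moreover have "(real n ^ 2 + real n + 5 / 36) / (real n + 1) ^ 2 > 0"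
    by (intro divide_pos_pos add_nonneg_pos) auto
  ultimately show ?case
    using Suc mult_le_one[of "(real n ^ 2 + real n + 5 / 36) / (real n + 1) ^ 2" "legendre_coeff n"]
    by (simp only: legendre_coeff.simps mult_pos_pos) auto
qed simp

lemma summable_legendre_coeff:
  fixes x :: real
  assumes "norm x < 1"
  shows "summable (\<lambda>n. legendre_coeff n * x ^ n)"
proof (rule summable_comparison_test)
  show "\<exists>N. \<forall>n\<ge>N. norm (legendre_coeff n * x ^ n) \<le> norm x ^ n"
  proof (intro exI[of _ 0] allI impI)
    show "norm (legendre_coeff n * x ^ n) \<le> norm x ^ n" for n
      using legendre_coeff_bounds[of n] by (simp add: abs_mult power_abs mult_left_le_one_le)
  qed
  show "summable (\<lambda>n. norm x ^ n)"
    using assms by (simp add: summable_geometric)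
qed

lemma summable_diffs_legendre_coeff:
  fixes x :: real
  assumes "norm x < 1"
  shows "summable (\<lambda>n. diffs legendre_coeff n * x ^ n)" "summable (\<lambda>n. diffs (diffs legendre_coeff) n * x ^ n)"
    "summable (\<lambda>n. diffs (diffs (diffs legendre_coeff)) n * x ^ n)"
  using termdiff_converges[of _ 1] summable_legendre_coeff assms by (metis (full_types))+

definition legendre0 :: "real \<Rightarrow> real" where "legendre0 x = (\<Sum>n. legendre_coeff n * x ^ n)"
definition legendre1 :: "real \<Rightarrow> real" where "legendre1 x = (\<Sum>n. diffs legendre_coeff n * x ^ n)"
definition legendre2 :: "real \<Rightarrow> real" where "legendre2 x = (\<Sum>n. diffs (diffs legendre_coeff) n * x ^ n)"

lemma DERIV_legendre:
  assumes "\<bar>x\<bar> < 1"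
  shows "(legendre0 has_real_derivative legendre1 x) (at x)" "(legendre1 has_real_derivative legendre2 x) (at x)" "isCont legendre2 x"
proof -
  show "(legendre0 has_real_derivative legendre1 x) (at x)"
    unfolding legendre0_def legendre1_def by (rule termdiffs_strong'[of 1]) (use summable_legendre_coeff assms in auto)
  show "(legendre1 has_real_derivative legendre2 x) (at x)"
    unfolding legendre1_def legendre2_def by (rule termdiffs_strong'[of 1]) (use summable_diffs_legendre_coeff assms in auto)
  have "(legendre2 has_real_derivative (\<Sum>n. diffs (diffs (diffs legendre_coeff)) n * x ^ n)) (at x)"
    unfolding legendre2_def by (rule termdiffs_strong'[of 1]) (use summable_diffs_legendre_coeff assms in auto)
  then show "isCont legendre2 x" by (rule DERIV_isCont)
qed

lemma legendre0_zero: "legendre0 0 = 1"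
  using powser_zero[of legendre_coeff] by (simp add: legendre0_def)

text \<open>The hypergeometric equation. Comparing the coefficients of \<open>x ^ n\<close> leaves
  exactly the recursion of \<open>legendre_coeff\<close>.\<close>

lemma legendre_ode:
  assumes "\<bar>x\<bar> < 1"
  shows "x * (1 - x) * legendre2 x + (1 - 2 * x) * legendre1 x = 5 / 36 * legendre0 x"
proof -
  \<comment> \<open>\<open>s\<close>, \<open>q\<close>, \<open>r\<close> are the series of
    \<open>x f''\<close>, \<open>x f'\<close>, \<open>x^2 f''\<close> for
    \<open>f = legendre0\<close>, indexed by the power of \<open>x\<close>. The factors
    \<open>n\<close> and \<open>n - 1\<close> annihilate the initial terms, so the index shifts
    below lose nothing.\<close>
  define s where "s = (\<lambda>n. real n * x ^ n * diffs legendre_coeff n)"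
  define q where "q = (\<lambda>n. real n * legendre_coeff n * x ^ n)"
  define r where "r = (\<lambda>n. real n * (real n - 1) * legendre_coeff n * x ^ n)"
  have a: "(\<lambda>n. legendre_coeff n * x ^ n) sums legendre0 x" "(\<lambda>n. diffs legendre_coeff n * x ^ n) sums legendre1 x"
     "(\<lambda>n. diffs (diffs legendre_coeff) n * x ^ n) sums legendre2 x"
    using summable_legendre_coeff[of x] summable_diffs_legendre_coeff[of x] assms
    by (auto simp: legendre0_def legendre1_def legendre2_def summable_sums)
  have "(\<lambda>n. real (Suc n) * legendre_coeff (Suc n) * x ^ Suc n) sums (x * legendre1 x)"
    using sums_mult[OF a(2), of x] by (simp add: diffs_def mult_ac)
  then have 1: "q sums (x * legendre1 x)"
    using sums_Suc_iff[of q "x * legendre1 x"] by (simp add: q_def)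
  have "(\<lambda>n. s (Suc n)) sums (x * legendre2 x)"
    using sums_mult[OF a(3), of x] by (simp add: diffs_def s_def mult_ac)
  then have 2: "s sums (x * legendre2 x)"
    using sums_Suc_iff[of s "x * legendre2 x"] by (simp add: s_def)
  have "(\<lambda>n. r (Suc (Suc n))) sums (x\<^sup>2 * legendre2 x)"
    using sums_mult[OF a(3), of "x\<^sup>2"] by (simp add: diffs_def r_def mult_ac power2_eq_square)
  then have 3: "r sums (x\<^sup>2 * legendre2 x)"
    using sums_Suc_iff[of r "x\<^sup>2 * legendre2 x"] sums_Suc_iff[of "\<lambda>n. r (Suc n)" "x\<^sup>2 * legendre2 x"] by (simp add: r_def)
  have "(\<lambda>n. s n - r n + diffs legendre_coeff n * x ^ n - 2 * q n) sums
     (x * legendre2 x - x\<^sup>2 * legendre2 x + legendre1 x - 2 * (x * legendre1 x))"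
    by (intro sums_diff sums_add sums_mult 1 2 3 a)
  moreover have "s n - r n + diffs legendre_coeff n * x ^ n - 2 * q n = 5 / 36 * (legendre_coeff n * x ^ n)" for n
  proof -
    have "(real n + 1)\<^sup>2 * legendre_coeff (Suc n) = (real n ^ 2 + real n + 5 / 36) * legendre_coeff n"
      by (simp add: add_nonneg_eq_0_iff)
    then have "(real n + 1)\<^sup>2 * legendre_coeff (Suc n) - real n * (real n - 1) * legendre_coeff n - 2 * real n * legendre_coeff n = 5 / 36 * legendre_coeff n"
      by (simp add: algebra_simps power2_eq_square)
    then have "((real n + 1)\<^sup>2 * legendre_coeff (Suc n) - real n * (real n - 1) * legendre_coeff n - 2 * real n * legendre_coeff n) * x ^ n
       = 5 / 36 * legendre_coeff n * x ^ n"
      by simp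
    then show ?thesis
      by (simp add: s_def r_def q_def diffs_def algebra_simps power2_eq_square del: legendre_coeff.simps)
  qed
  ultimately have "(\<lambda>n. 5 / 36 * (legendre_coeff n * x ^ n)) sums
     (x * legendre2 x - x\<^sup>2 * legendre2 x + legendre1 x - 2 * (x * legendre1 x))" by simp
  moreover have "(\<lambda>n. 5 / 36 * (legendre_coeff n * x ^ n)) sums (5 / 36 * legendre0 x)"
    by (intro sums_mult a)
  ultimately have "x * legendre2 x - x\<^sup>2 * legendre2 x + legendre1 x - 2 * (x * legendre1 x) = 5 / 36 * legendre0 x"
    by (rule sums_unique2)
  then show ?thesis by (simp add: algebra_simps power2_eq_square)
qed

text \<open>
  Here \<open>kf\<close> is \<open>2 J'/J\<close>. The suffixes \<open>d\<close> and \<open>dd\<close> mark derivatives; they are given in a form free of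
  division by \<open>1 - u\<^sup>2\<close>, which vanishes on the central circle. Up to the factor \<open>J\<^sup>2\<close>, \<open>nf\<close> is the
  reciprocal of the proportionality factor between \<open>u\<^sub>t\<close> and \<open>w + W/2\<close>, and \<open>bf\<close> gives the swirl.
\<close>

definition Jf :: "real \<Rightarrow> real" where "Jf u = legendre0 ((1 - u) / 2)"
definition kf :: "real \<Rightarrow> real" where "kf u = - legendre1 ((1 - u) / 2) / Jf u"
definition kd :: "real \<Rightarrow> real" where "kd u = legendre2 ((1 - u) / 2) / (2 * Jf u) - (kf u)\<^sup>2 / 2"
definition Wf :: "real \<Rightarrow> real" where "Wf u = u - 3 * (1 - u\<^sup>2) * kf u"
definition Wd :: "real \<Rightarrow> real" where "Wd u = (1 + 3 * kf u * (u - Wf u)) / 6"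
definition Wdd :: "real \<Rightarrow> real" where
  "Wdd u = (3 * kd u * (u - Wf u) + 3 * kf u * (1 - Wd u)) / 6"
definition nf :: "real \<Rightarrow> real" where "nf u = (Wf u * Wd u + ((Wf u)\<^sup>2 - 1) * kf u) / 2"
definition nd :: "real \<Rightarrow> real" where
  "nd u = ((Wd u)\<^sup>2 + Wf u * Wdd u + 2 * Wf u * Wd u * kf u + ((Wf u)\<^sup>2 - 1) * kd u) / 2"
definition bf :: "real \<Rightarrow> real" where "bf u = u + 3 * Wf u - 4 * Wf u ^ 3"

lemma coeff_one: "Jf 1 = 1" "Wf 1 = 1" "Wd 1 = 1 / 6" "nf 1 = 1 / 12" "bf 1 = 0"
  by (simp_all add: Jf_def Wf_def Wd_def nf_def bf_def legendre0_zero)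

text \<open>The Legendre equation divided by \<open>Jf\<close> is a Riccati equation for
  \<open>kf\<close>. Rewritten with \<open>Wd\<close> it is \<open>kd_rel\<close>, which in turn
  identifies the derivative of \<open>Wf\<close> with the division-free expression
  \<open>Wd\<close>; the remaining derivatives follow by the product rule.\<close>

lemma coeff_derivs:
  assumes "\<bar>u - 1\<bar> < 2" "Jf u \<noteq> 0"
  shows DERIV_Jf: "(Jf has_real_derivative Jf u * kf u / 2) (at u)"
    and DERIV_kf: "(kf has_real_derivative kd u) (at u)"
    and DERIV_Wf: "(Wf has_real_derivative Wd u) (at u)"
    and DERIV_Wd: "(Wd has_real_derivative Wdd u) (at u)"
    and DERIV_nf: "(nf has_real_derivative nd u) (at u)"
    and isCont_kd: "isCont kd u"
    and kd_rel: "3 * kd u * (1 - u\<^sup>2) - 6 * u * kf u = 1 - Wd u"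
proof -
  let ?x = "(1 - u) / 2"
  have x: "\<bar>?x\<bar> < 1" using assms by auto
  have dx: "((\<lambda>u. (1 - u) / 2) has_real_derivative - (1 / 2)) (at u)"
    by (auto intro!: derivative_eq_intros)
  have J: "(Jf has_real_derivative - legendre1 ?x / 2) (at u)"
    unfolding Jf_def[abs_def] using DERIV_chain2[OF DERIV_legendre(1)[OF x] dx] by simp
  then show J': "(Jf has_real_derivative Jf u * kf u / 2) (at u)"
    using assms by (simp add: kf_def)
  have 1: "((\<lambda>u. legendre1 ((1 - u) / 2)) has_real_derivative - legendre2 ?x / 2) (at u)"
    using DERIV_chain2[OF DERIV_legendre(2)[OF x] dx] by simp
  show k: "(kf has_real_derivative kd u) (at u)"
    unfolding kf_def[abs_def]
    by (rule derivative_eq_intros J' 1 assms refl)+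
       (use assms in \<open>simp add: kd_def kf_def field_simps power2_eq_square\<close>)
  have "isCont (\<lambda>u. legendre2 ((1 - u) / 2)) u"
    using continuous_at_compose[OF DERIV_isCont[OF dx], of legendre2] DERIV_legendre(3)[OF x] by (simp add: o_def)
  then show "isCont kd u"
    unfolding kd_def[abs_def] using DERIV_isCont[OF J] DERIV_isCont[OF k] assms
    by (intro continuous_intros) auto
  have "?x * (1 - ?x) * legendre2 ?x + (1 - 2 * ?x) * legendre1 ?x = 5 / 36 * legendre0 ?x"
    by (rule legendre_ode[OF x])
  then have ode: "(1 - u\<^sup>2) * legendre2 ?x + 4 * u * legendre1 ?x = 5 / 9 * Jf u"
    by (simp add: Jf_def field_simps power2_eq_square)
  have f1: "legendre1 ?x = - kf u * Jf u" and f2: "legendre2 ?x = (kd u + (kf u)\<^sup>2 / 2) * (2 * Jf u)"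
    using assms by (simp_all add: kf_def kd_def)
  have "Jf u * (2 * (1 - u\<^sup>2) * (kd u + (kf u)\<^sup>2 / 2) - 4 * u * kf u - 5 / 9) = 0"
    using ode unfolding f1 f2 by (simp add: algebra_simps)
  then have kr: "2 * (1 - u\<^sup>2) * (kd u + (kf u)\<^sup>2 / 2) - 4 * u * kf u - 5 / 9 = 0"
    using assms by simp
  show rel: "3 * kd u * (1 - u\<^sup>2) - 6 * u * kf u = 1 - Wd u"
    using kr unfolding Wd_def Wf_def by (simp add: field_simps power2_eq_square)
  have "(Wf has_real_derivative (1 + 6 * u * kf u - 3 * (1 - u\<^sup>2) * kd u)) (at u)"
    unfolding Wf_def[abs_def]
    by (rule derivative_eq_intros k refl)+ (simp add: algebra_simps)
  moreover have "1 + 6 * u * kf u - 3 * (1 - u\<^sup>2) * kd u = Wd u"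
    using rel by (simp add: algebra_simps)
  ultimately show W: "(Wf has_real_derivative Wd u) (at u)" by simp
  show W': "(Wd has_real_derivative Wdd u) (at u)"
    unfolding Wd_def[abs_def]
    by (rule derivative_eq_intros k W refl)+ (simp_all add: Wdd_def field_simps)
  show "(nf has_real_derivative nd u) (at u)"
    unfolding nf_def[abs_def]
    by (rule derivative_eq_intros k W W' refl)+ (simp_all add: nd_def field_simps power2_eq_square)
qed

lemma Wf_rel: "3 * kf u * (1 - u\<^sup>2) = u - Wf u"
  by (simp add: Wf_def)

lemma continuous_at_near:
  fixes f :: "real \<Rightarrow> real"
  assumes "isCont f a" "f a > c"
  shows "\<exists>e>0. \<forall>u. \<bar>u - a\<bar> < e \<longrightarrow> f u > c"
proof -
  have "\<forall>\<^sub>F x in nhds a. c < f x"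
    using assms by (intro order_tendstoD(1)[of f "f a"]) (auto simp: isCont_def tendsto_at_iff_tendsto_nhds)
  then show ?thesis by (auto simp: eventually_nhds_metric dist_real_def)
qed

text \<open>\<open>Jf\<close> and \<open>nf\<close> are positive at 1 and continuous.
  \<open>bf\<close> vanishes at 1 with slope \<open>-1/2\<close>, so it is positive just to the
  left, on the side where \<open>u\<close> will take its values.\<close>

lemma coeff_range:
  obtains e where "0 < e" "e \<le> 1" "\<And>u. \<bar>u - 1\<bar> < e \<Longrightarrow> Jf u > 0"
    "\<And>u. \<bar>u - 1\<bar> < e \<Longrightarrow> nf u > 0" "\<And>u. 1 - e < u \<Longrightarrow> u < 1 \<Longrightarrow> bf u > 0"
proof -
  have J1: "Jf 1 \<noteq> 0" by (simp add: coeff_one)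
  note d = coeff_derivs[of 1, simplified, OF J1]
  obtain e1 where e1: "e1 > 0" "\<And>u. \<bar>u - 1\<bar> < e1 \<Longrightarrow> Jf u > 0"
    using continuous_at_near[OF DERIV_isCont[OF d(1)], of 0] by (auto simp: coeff_one)
  obtain e2 where e2: "e2 > 0" "\<And>u. \<bar>u - 1\<bar> < e2 \<Longrightarrow> nf u > 0"
    using continuous_at_near[OF DERIV_isCont[OF d(5)], of 0] by (auto simp: coeff_one)
  have "(bf has_real_derivative - (1 / 2)) (at 1)"
    unfolding bf_def[abs_def]
    by (rule derivative_eq_intros d refl)+ (simp add: coeff_one)
  from DERIV_neg_dec_left[OF this] obtain e3 where e3: "e3 > 0" "\<And>h. 0 < h \<Longrightarrow> h < e3 \<Longrightarrow> bf 1 < bf (1 - h)"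
    by auto
  show ?thesis
  proof (rule that[of "min 1 (min e1 (min e2 e3))"])
    fix u :: real assume "1 - min 1 (min e1 (min e2 e3)) < u" "u < 1"
    then show "bf u > 0" using e3(2)[of "1 - u"] by (simp add: coeff_one)
  qed (use e1 e2 e3 in auto)
qed

subsection \<open>Potentials and inverse functions in the plane\<close>

text \<open>A closed form \<open>F dx + Q dy\<close> on a rectangle is exact. The potential
  integrates up the left edge and then horizontally: its x-derivative comes from the fundamental
  theorem, its y-derivative from differentiation under the integral, and continuity of
  \<open>Q\<close> makes the partial derivatives a total one.\<close>

lemma poincare_rectangle:
  fixes F Q G :: "real \<Rightarrow> real \<Rightarrow> real"
  assumes F: "\<And>x y. x \<in> {a..b} \<Longrightarrow> y \<in> {c..d} \<Longrightarrow> ((\<lambda>y. F x y) has_real_derivative G x y) (at y)"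
    and Q: "\<And>x y. x \<in> {a..b} \<Longrightarrow> y \<in> {c..d} \<Longrightarrow> ((\<lambda>x. Q x y) has_real_derivative G x y) (at x)"
    and cF: "continuous_on ({a..b} \<times> {c..d}) (\<lambda>(x, y). F x y)"
    and cQ: "continuous_on ({a..b} \<times> {c..d}) (\<lambda>(x, y). Q x y)"
    and cG: "continuous_on ({a..b} \<times> {c..d}) (\<lambda>(x, y). G x y)"
  obtains z :: "real \<times> real \<Rightarrow> real" where
    "\<And>x y. a < x \<Longrightarrow> x < b \<Longrightarrow> c < y \<Longrightarrow> y < d \<Longrightarrow>
      (z has_derivative (\<lambda>h. F x y * fst h + Q x y * snd h)) (at (x, y))"
proof
  define z where "z = (\<lambda>x y. integral {a..x} (\<lambda>s. F s y) + integral {c..y} (Q a))"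
  fix x y assume xy: "a < x" "x < b" "c < y" "y < d"
  let ?X = "{a<..<b}" and ?Y = "{c<..<d}"
  have cFx: "continuous_on {a..b} (\<lambda>s. F s y)" if "y \<in> {c..d}" for y
  proof -
    have "continuous_on {a..b} (\<lambda>s. (\<lambda>(x, y). F x y) (s, y))"
      by (rule continuous_on_compose2[OF cF]) (use that in \<open>auto intro!: continuous_intros\<close>)
    then show ?thesis by simp
  qed
  have cQa: "continuous_on {c..d} (Q a)"
  proof -
    have "continuous_on {c..d} (\<lambda>s. (\<lambda>(x, y). Q x y) (a, s))"
      by (rule continuous_on_compose2[OF cQ]) (use xy in \<open>auto intro!: continuous_intros\<close>)
    then show ?thesis by simp
  qed
  have zx: "((\<lambda>x. z x y) has_derivative (\<lambda>h. F x y * h)) (at x within ?X)"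
  proof -
    have "((\<lambda>x. integral {a..x} (\<lambda>s. F s y)) has_real_derivative F x y) (at x within {a..b})"
      by (rule integral_has_real_derivative[OF cFx]) (use xy in auto)
    then have "((\<lambda>x. integral {a..x} (\<lambda>s. F s y)) has_real_derivative F x y) (at x within ?X)"
      by (rule has_field_derivative_subset) auto
    then have "((\<lambda>x. z x y) has_real_derivative F x y) (at x within ?X)"
      unfolding z_def by (auto intro!: derivative_eq_intros)
    then show ?thesis by (simp add: has_field_derivative_def)
  qed
  have zy: "((\<lambda>y. z x y) has_derivative blinfun_apply (blinfun_mult_right (Q x y))) (at y within ?Y)"
    if "x \<in> ?X" "y \<in> ?Y" for x y
  proof -
    have "((\<lambda>y. integral (cbox a x) (\<lambda>s. F s y)) has_real_derivative integral (cbox a x) (\<lambda>s. G s y)) (at y within {c..d})"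
    proof (rule leibniz_rule_field_derivative)
      show "((\<lambda>y. F s y) has_real_derivative G s y) (at y within {c..d})" if "y \<in> {c..d}" "s \<in> cbox a x" for y s
        using has_field_derivative_at_within[OF F[of s y]] that \<open>x \<in> ?X\<close> by simp
      show "(\<lambda>s. F s y) integrable_on cbox a x" if "y \<in> {c..d}" for y
        using continuous_on_subset[OF cFx[OF that]] \<open>x \<in> ?X\<close> by (intro integrable_continuous) auto
      show "continuous_on ({c..d} \<times> cbox a x) (\<lambda>(y, s). G s y)"
      proof -
        have "continuous_on ({c..d} \<times> cbox a x) (\<lambda>p. (\<lambda>(x, y). G x y) (snd p, fst p))"
          by (rule continuous_on_compose2[OF cG]) (use \<open>x \<in> ?X\<close> in \<open>auto intro!: continuous_intros\<close>)
        then show ?thesis by (simp add: split_beta)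
      qed
    qed (use that in auto)
    moreover have "((\<lambda>s. G s y) has_integral (Q x y - Q a y)) {a..x}"
    proof (rule fundamental_theorem_of_calculus)
      show "((\<lambda>x. Q x y) has_vector_derivative G s y) (at s within {a..x})" if "s \<in> {a..x}" for s
        using Q[of s y] that \<open>x \<in> ?X\<close> \<open>y \<in> ?Y\<close>
        by (simp add: has_real_derivative_iff_has_vector_derivative has_vector_derivative_at_within)
    qed (use that in auto)
    ultimately have "((\<lambda>y. integral {a..x} (\<lambda>s. F s y)) has_real_derivative Q x y - Q a y) (at y within {c..d})"
      by (simp add: integral_unique)
    moreover have "((\<lambda>y. integral {c..y} (Q a)) has_real_derivative Q a y) (at y within {c..d})"
      by (rule integral_has_real_derivative[OF cQa]) (use that in auto)
    ultimately have "((\<lambda>y. z x y) has_real_derivative Q x y) (at y within {c..d})"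
      unfolding z_def using DERIV_add by fastforce
    then have "((\<lambda>y. z x y) has_real_derivative Q x y) (at y within ?Y)"
      by (rule has_field_derivative_subset) auto
    then show ?thesis by (simp add: has_field_derivative_def)
  qed
  have "((\<lambda>(x, y). z x y) has_derivative (\<lambda>(tx, ty). F x y * tx + blinfun_mult_right (Q x y) ty))
      (at (x, y) within ?X \<times> ?Y)"
  proof (rule has_derivative_partialsI[OF zx zy])
    have "continuous_on (?X \<times> ?Y) (\<lambda>p. blinfun_mult_right ((\<lambda>(x, y). Q x y) p))"
      by (intro continuous_intros continuous_on_subset[OF cQ]) auto
    then show "continuous (at (x, y) within ?X \<times> ?Y) (\<lambda>(x, y). blinfun_mult_right (Q x y))"
      using xy by (auto simp: continuous_on_eq_continuous_within case_prod_unfold)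
  qed (use xy in auto)
  then show "((\<lambda>(x, y). z x y) has_derivative (\<lambda>h. F x y * fst h + Q x y * snd h)) (at (x, y))"
    using xy by (subst (asm) at_within_open) (auto simp: open_Times case_prod_unfold)
qed

text \<open>The inverse function theorem with the derivative given as a 2 by 2 matrix, so that the
  derivative of the inverse is explicit by Cramer's rule.\<close>

lemma plane_inverse_function:
  fixes f :: "real \<times> real \<Rightarrow> real \<times> real" and a b c d :: "real \<times> real \<Rightarrow> real"
  assumes U: "open U" "p0 \<in> U"
    and f: "\<And>p. p \<in> U \<Longrightarrow> (f has_derivative (\<lambda>h. (a p * fst h + b p * snd h, c p * fst h + d p * snd h))) (at p)"
    and cont: "continuous_on U a" "continuous_on U b" "continuous_on U c" "continuous_on U d"
    and det: "\<And>p. p \<in> U \<Longrightarrow> a p * d p - b p * c p \<noteq> 0"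
  obtains U' V g where "open U'" "U' \<subseteq> U" "p0 \<in> U'" "open V" "f p0 \<in> V" "homeomorphism U' V f g"
    "\<And>y. y \<in> V \<Longrightarrow> (g has_derivative (\<lambda>h.
       let p = g y; D = a p * d p - b p * c p
       in ((d p * fst h - b p * snd h) / D, (a p * snd h - c p * fst h) / D))) (at y)"
proof -
  define B where "B = (\<lambda>i j. Blinfun (\<lambda>h :: real \<times> real. (i h, j h) :: real \<times> real))"
  have B: "blinfun_apply (B i j) = (\<lambda>h. (i h, j h))" if "bounded_linear i" "bounded_linear j" for i j
    unfolding B_def using that by (intro bounded_linear_Blinfun_apply bounded_linear_Pair)
  define f' where "f' = (\<lambda>p. a p *\<^sub>R B fst (\<lambda>_. 0) + b p *\<^sub>R B snd (\<lambda>_. 0)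
     + c p *\<^sub>R B (\<lambda>_. 0) fst + d p *\<^sub>R B (\<lambda>_. 0) snd)"
  have f': "blinfun_apply (f' p) = (\<lambda>h. (a p * fst h + b p * snd h, c p * fst h + d p * snd h))" for p
    by (auto simp: f'_def blinfun.bilinear_simps B bounded_linear_fst bounded_linear_snd)
  define I where "I = (\<lambda>p h. let D = a p * d p - b p * c p
       in ((d p * fst h - b p * snd h) / D, (a p * snd h - c p * fst h) / D))"
  have I1: "I p (blinfun_apply (f' p) h) = h" if "p \<in> U" for p h
  proof -
    have "d p * (a p * fst h + b p * snd h) - b p * (c p * fst h + d p * snd h) = (a p * d p - b p * c p) * fst h"
      "a p * (c p * fst h + d p * snd h) - c p * (a p * fst h + b p * snd h) = (a p * d p - b p * c p) * snd h"
      by (simp_all add: algebra_simps)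
    then show ?thesis using det[OF that] by (simp add: I_def f')
  qed
  have bI: "bounded_linear (I p)" for p
    by (rule linear_conv_bounded_linear[THEN iffD1], rule linearI)
      (auto simp: I_def Let_def diff_divide_distrib add_divide_distrib algebra_simps)
  have 1: "(f has_derivative blinfun_apply (f' p)) (at p)" if "p \<in> U" for p
    using f[OF that] by (simp add: f')
  have 2: "continuous_on U f'"
    unfolding f'_def by (intro continuous_intros cont)
  have 3: "Blinfun (I p0) o\<^sub>L f' p0 = id_blinfun"
    by (rule blinfun_eqI) (simp add: bounded_linear_Blinfun_apply[OF bI] I1 U)
  obtain U' V g g' where *: "open U'" "U' \<subseteq> U" "p0 \<in> U'" "open V" "f p0 \<in> V" "homeomorphism U' V f g"
    "\<And>y. y \<in> V \<Longrightarrow> (g has_derivative (g' y)) (at y)"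
    "\<And>y. y \<in> V \<Longrightarrow> g' y = inv (blinfun_apply (f'(g y)))"
    "\<And>y. y \<in> V \<Longrightarrow> bij (blinfun_apply (f'(g y)))"
    using inverse_function_theorem[OF U(1) 1 2 U(2) 3] by blast
  show ?thesis
  proof (rule that[OF *(1-6)])
    fix y assume y: "y \<in> V"
    have "g y \<in> U" using y * by (auto simp: homeomorphism_def)
    \<comment> \<open>A left inverse of a bijection is its inverse.\<close>
    then have "g' y = I (g y)"
      using I1 *(8,9)[OF y] by (metis bij_inv_eq_iff ext)
    then show "(g has_derivative (\<lambda>h.
       let p = g y; D = a p * d p - b p * c p
       in ((d p * fst h - b p * snd h) / D, (a p * snd h - c p * fst h) / D))) (at y)"
      using *(7)[OF y] by (simp add: I_def Let_def)
  qed
qed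

subsection \<open>The coordinates and their potential\<close>

text \<open>
  A point \<open>p\<close> of the plane is the pair \<open>(\<xi>, w)\<close>, with \<open>(0, -1/2)\<close> over the central circle. \<open>ws\<close> is the
  derivative of \<open>W - t/J\<^sup>2\<close> with respect to \<open>u\<close> at fixed \<open>t\<close>.
\<close>

definition us :: "real \<times> real \<Rightarrow> real" where "us p = 4 * snd p ^ 3 - 3 * snd p - (fst p)\<^sup>2"
definition Cw :: "real \<times> real \<Rightarrow> real" where "Cw p = 12 * (snd p)\<^sup>2 - 3"
definition hs :: "real \<times> real \<Rightarrow> real" where "hs p = snd p + Wf (us p) / 2"
definition ws :: "real \<times> real \<Rightarrow> real" where "ws p = Wd (us p) + (Wf (us p) - snd p) * kf (us p)"
definition Ms :: "real \<times> real \<Rightarrow> real" where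
  "Ms p = 3 * Wd (us p) + (2 * Wf (us p) - 2 * snd p - hs p) * kf (us p)"
definition ts :: "real \<times> real \<Rightarrow> real" where "ts p = (Jf (us p))\<^sup>2 * (Wf (us p) - snd p)"

text \<open>Differentiating \<open>x^2 = 4 w^3 - 3 w - u\<close> in \<open>t\<close> expresses
  \<open>2 x\<close> times the t-derivative of \<open>x\<close> by this left side over
  \<open>n J^2\<close>. Its divisibility by \<open>x^2\<close> keeps that derivative regular at
  \<open>x = 0\<close>. The two sides differ by a multiple of the relation \<open>R\<close>.\<close>

lemma compat_algebra:
  fixes k u W W1 n h w x :: real
  assumes R: "3 * k * (1 - u\<^sup>2) = u - W" and e: "W1 = (1 + 3 * k * (u - W)) / 6" "n = (W * W1 + (W\<^sup>2 - 1) * k) / 2"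
    "h = w + W / 2" "x\<^sup>2 = 4 * w ^ 3 - 3 * w - u"
  shows "(12 * w\<^sup>2 - 3) * (h * (W1 + (W - w) * k) - n) - h = x\<^sup>2 * (3 * W1 + (2 * W - 2 * w - h) * k)"
proof -
  have "(12 * w\<^sup>2 - 3) * (h * (W1 + (W - w) * k) - n) - h - x\<^sup>2 * (3 * W1 + (2 * W - 2 * w - h) * k)
     = (u - W - 3 * k * (1 - u\<^sup>2)) / 2"
    unfolding e by (simp add: field_simps power2_eq_square power3_eq_cube)
  then show ?thesis using R by simp
qed

text \<open>Closedness of \<open>dz\<close>: up to the factor \<open>Jf\<close>, the left side is
  the w-derivative of \<open>zx\<close> and the right side the x-derivative of
  \<open>zw\<close>.\<close>

lemma closed_algebra:
  fixes k u W W1 n h w x :: real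
  assumes R: "3 * k * (1 - u\<^sup>2) = u - W"
    and e: "W1 = (1 + 3 * k * (u - W)) / 6" "n = (W * W1 + (W\<^sup>2 - 1) * k) / 2"
      "h = w + W / 2" "x\<^sup>2 = 4 * w ^ 3 - 3 * w - u"
    and R': "3 * k1 * (1 - u\<^sup>2) - 6 * u * k = 1 - W1"
    and e': "W2 = (3 * k1 * (u - W) + 3 * k * (1 - W1)) / 6"
      "n1 = (W1\<^sup>2 + W * W2 + 2 * W * W1 * k + (W\<^sup>2 - 1) * k1) / 2"
    and C: "C = 12 * w\<^sup>2 - 3" and m: "m = W1 + (W - w) * k" and M: "M = 3 * W1 + (2 * W - 2 * w - h) * k"
  shows "k * C * (h * m - n) + 2 * C * (h * (W2 + W1 * k + (W - w) * k1) + W1 / 2 * m - n1) + 2 * m - 2 * h * k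
    = k * x\<^sup>2 * M - M + 2 * x\<^sup>2 * (3 * W2 + (3 / 2 * W1) * k + (2 * W - 2 * w - h) * k1)"
proof -
  have 1: "C * (h * m - n) - h = x\<^sup>2 * M"
    unfolding C m M by (rule compat_algebra[OF R e])
  \<comment> \<open>The u-derivative at fixed \<open>w\<close> of the identity behind
    \<open>compat_algebra\<close>, where \<open>x^2\<close> has derivative -1. The right side
    vanishes by \<open>R'\<close>, the derivative of \<open>R\<close>.\<close>
  have "C * (h * (W2 + W1 * k + (W - w) * k1) + W1 / 2 * m - n1) - W1 / 2 + M
     - x\<^sup>2 * (3 * W2 + (3 / 2 * W1) * k + (2 * W - 2 * w - h) * k1)
     = (1 - W1 - 3 * k1 * (1 - u\<^sup>2) + 6 * u * k) / 2"
    unfolding C m M e' e by (simp add: field_simps power2_eq_square power3_eq_cube)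
  then have 2: "C * (h * (W2 + W1 * k + (W - w) * k1) + W1 / 2 * m - n1) - W1 / 2 + M
     = x\<^sup>2 * (3 * W2 + (3 / 2 * W1) * k + (2 * W - 2 * w - h) * k1)"
    using R' by simp
  have 3: "W1 + 2 * m - h * k = M" unfolding m M by (simp add: algebra_simps)
  have "k * C * (h * m - n) + 2 * C * (h * (W2 + W1 * k + (W - w) * k1) + W1 / 2 * m - n1) + 2 * m - 2 * h * k
     = k * (C * (h * m - n) - h) + 2 * (C * (h * (W2 + W1 * k + (W - w) * k1) + W1 / 2 * m - n1) - W1 / 2 + M)
       + (W1 + 2 * m - h * k) - 2 * M"
    by (simp add: algebra_simps)
  then show ?thesis unfolding 1 2 3 by (simp add: algebra_simps)
qed

lemma fst_square: "(fst p)\<^sup>2 = 4 * snd p ^ 3 - 3 * snd p - us p"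
  by (simp add: us_def)

lemma compat: "Cw p * (hs p * ws p - nf (us p)) - hs p = (fst p)\<^sup>2 * Ms p"
  unfolding Cw_def ws_def Ms_def by (rule compat_algebra[OF Wf_rel Wd_def nf_def hs_def fst_square])

lemma us_center: "us (0, - (1 / 2)) = 1"
  by (simp add: us_def power3_eq_cube)

text \<open>\<open>4 w^3 - 3 w\<close> is the Chebyshev polynomial \<open>T_3\<close>, which takes
  the value 1 doubly at \<open>w = -1/2\<close>. Hence on \<open>w < 1\<close> the function
  \<open>us\<close> has its strict maximum 1 at the centre, which is why nearby level curves close
  up.\<close>

lemma one_minus_us: "1 - us p = (fst p)\<^sup>2 + (1 - snd p) * (2 * snd p + 1)\<^sup>2"
  by (simp add: us_def algebra_simps power2_eq_square power3_eq_cube)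

lemma us_le_one: "snd p \<le> 1 \<Longrightarrow> us p \<le> 1"
  using one_minus_us[of p] by (smt (verit) mult_nonneg_nonneg zero_le_power2)

lemma us_eq_one_iff:
  assumes "snd p < 1"
  shows "us p = 1 \<longleftrightarrow> p = (0, - (1 / 2))"
proof
  assume "us p = 1"
  then have "(fst p)\<^sup>2 + (1 - snd p) * (2 * snd p + 1)\<^sup>2 = 0"
    using one_minus_us[of p] by simp
  then have "(fst p)\<^sup>2 = 0" "(1 - snd p) * (2 * snd p + 1)\<^sup>2 = 0"
    using assms by (smt (verit) mult_nonneg_nonneg zero_le_power2)+
  then show "p = (0, - (1 / 2))"
    using assms by (cases p) auto
qed (use us_center in simp)

lemma us_derivative: "(us has_derivative (\<lambda>h. Cw p * snd h - 2 * fst p * fst h)) (at p)"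
  unfolding us_def[abs_def]
  by (rule derivative_eq_intros refl)+ (simp add: fun_eq_iff Cw_def algebra_simps power2_eq_square)

lemma continuous_on_us [continuous_intros]:
  "continuous_on S f \<Longrightarrow> continuous_on S (\<lambda>x. us (f x))"
  unfolding us_def by (intro continuous_intros)

text \<open>\<open>zx\<close> and \<open>zw\<close> are the partial derivatives of \<open>z\<close>, and \<open>zxw\<close> is the mixed one.\<close>

definition zx :: "real \<times> real \<Rightarrow> real" where "zx p = - 2 * Jf (us p) * (nf (us p) - hs p * ws p)"
definition zw :: "real \<times> real \<Rightarrow> real" where "zw p = - Jf (us p) * fst p * Ms p"
definition zxw :: "real \<times> real \<Rightarrow> real" where
  "zxw p = Jf (us p) * (kf (us p) * Cw p * (hs p * ws p - nf (us p))
    + 2 * Cw p * (hs p * (Wdd (us p) + Wd (us p) * kf (us p) + (Wf (us p) - snd p) * kd (us p))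
    + Wd (us p) / 2 * ws p - nd (us p)) + 2 * ws p - 2 * hs p * kf (us p))"

text \<open>\<open>zxw\<close> is written as the w-derivative of \<open>zx\<close>; in this second
  form it is the x-derivative of \<open>zw\<close>.\<close>

lemma zxw_eq:
  assumes "\<bar>us p - 1\<bar> < 2" "Jf (us p) \<noteq> 0"
  shows "zxw p = Jf (us p) * (kf (us p) * (fst p)\<^sup>2 * Ms p - Ms p + 2 * (fst p)\<^sup>2 *
    (3 * Wdd (us p) + (3 / 2 * Wd (us p)) * kf (us p) + (2 * Wf (us p) - 2 * snd p - hs p) * kd (us p)))"
  unfolding zxw_def
  by (subst closed_algebra[OF Wf_rel Wd_def nf_def hs_def fst_square coeff_derivs(7)[OF assms]
        Wdd_def nd_def Cw_def ws_def Ms_def]) (rule refl)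

lemma zx_zw_derivs:
  assumes "\<bar>us (x, w) - 1\<bar> < 2" "Jf (us (x, w)) \<noteq> 0"
  shows "((\<lambda>w. zx (x, w)) has_real_derivative zxw (x, w)) (at w)"
    and "((\<lambda>x. zw (x, w)) has_real_derivative zxw (x, w)) (at x)"
proof -
  note d = coeff_derivs[OF assms]
  have uw: "((\<lambda>w. us (x, w)) has_real_derivative Cw (x, w)) (at w)"
    unfolding us_def fst_conv snd_conv by (rule derivative_eq_intros refl)+ (simp add: Cw_def)
  have ux: "((\<lambda>x. us (x, w)) has_real_derivative (- 2 * x)) (at x)"
    unfolding us_def fst_conv snd_conv by (rule derivative_eq_intros refl)+ simp
  note w = d(1-5)[THEN DERIV_chain2[where g = "\<lambda>w. us (x, w)" and x = w, OF _ uw]]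
    and x = d(1-5)[THEN DERIV_chain2[where g = "\<lambda>x. us (x, w)" and x = x, OF _ ux]]
  have hw: "((\<lambda>w. hs (x, w)) has_real_derivative 1 + Wd (us (x, w)) * Cw (x, w) / 2) (at w)"
    and hx: "((\<lambda>x. hs (x, w)) has_real_derivative Wd (us (x, w)) * (- 2 * x) / 2) (at x)"
    unfolding hs_def snd_conv by (auto intro!: derivative_eq_intros w x)
  have ww: "((\<lambda>w. ws (x, w)) has_real_derivative
      Wdd (us (x, w)) * Cw (x, w) + (Wd (us (x, w)) * Cw (x, w) - 1) * kf (us (x, w))
      + (Wf (us (x, w)) - w) * (kd (us (x, w)) * Cw (x, w))) (at w)"
    unfolding ws_def snd_conv by (auto intro!: derivative_eq_intros w)
  have Mx: "((\<lambda>x. Ms (x, w)) has_real_derivative 3 * (Wdd (us (x, w)) * (- 2 * x))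
      + (2 * (Wd (us (x, w)) * (- 2 * x)) - Wd (us (x, w)) * (- 2 * x) / 2) * kf (us (x, w))
      + (2 * Wf (us (x, w)) - 2 * w - hs (x, w)) * (kd (us (x, w)) * (- 2 * x))) (at x)"
    unfolding Ms_def snd_conv by (auto intro!: derivative_eq_intros x hx)
  show "((\<lambda>w. zx (x, w)) has_real_derivative zxw (x, w)) (at w)"
    unfolding zx_def
    by (rule derivative_eq_intros w hw ww refl)+ (simp add: zxw_def ws_def field_simps)
  show "((\<lambda>x. zw (x, w)) has_real_derivative zxw (x, w)) (at x)"
    unfolding zw_def fst_conv zxw_eq[OF assms]
    by (rule derivative_eq_intros x Mx refl)+
       (simp add: field_simps power2_eq_square)
qed

lemma continuous_on_coeffs:
  assumes "\<And>p. p \<in> S \<Longrightarrow> \<bar>us p - 1\<bar> < 2 \<and> Jf (us p) \<noteq> 0"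
  shows "continuous_on S (\<lambda>p. Jf (us p))" "continuous_on S (\<lambda>p. kf (us p))"
    "continuous_on S (\<lambda>p. Wf (us p))" "continuous_on S (\<lambda>p. Wd (us p))"
    "continuous_on S (\<lambda>p. nf (us p))" "continuous_on S (\<lambda>p. kd (us p))"
    and continuous_on_hs: "continuous_on S hs" and continuous_on_ws: "continuous_on S ws"
    and continuous_on_Ms: "continuous_on S Ms"
    and "continuous_on S zx" "continuous_on S zw" "continuous_on S zxw"
    and continuous_on_Cw: "continuous_on S Cw"
proof -
  have *: "continuous_on S (\<lambda>p. f (us p))" if "\<And>p. p \<in> S \<Longrightarrow> isCont f (us p)" for f :: "real \<Rightarrow> real"
    using that by (intro continuous_on_compose2[of "us ` S" f S us])
      (auto intro!: continuous_at_imp_continuous_on continuous_intros)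
  show 1: "continuous_on S (\<lambda>p. Jf (us p))" "continuous_on S (\<lambda>p. kf (us p))"
    "continuous_on S (\<lambda>p. Wf (us p))" "continuous_on S (\<lambda>p. Wd (us p))"
    "continuous_on S (\<lambda>p. nf (us p))" "continuous_on S (\<lambda>p. kd (us p))"
    using assms by (auto intro!: * intro: coeff_derivs(1-5)[THEN DERIV_isCont] coeff_derivs(6))
  show 2: "continuous_on S hs" "continuous_on S ws"
    unfolding hs_def[abs_def] ws_def[abs_def] by (intro continuous_intros 1; simp)+
  show 3: "continuous_on S Ms" unfolding Ms_def[abs_def] by (intro continuous_intros 1 2)
  show 4: "continuous_on S Cw" unfolding Cw_def[abs_def] by (intro continuous_intros)
  show "continuous_on S zx" "continuous_on S zw" "continuous_on S zxw"
    unfolding zx_def[abs_def] zw_def[abs_def] zxw_def[abs_def] Wdd_def nd_def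
    by (intro continuous_intros 1 2 3 4; simp)+
qed

lemma ts_derivative:
  assumes "\<bar>us p - 1\<bar> < 2" "Jf (us p) \<noteq> 0"
  shows "(ts has_derivative (\<lambda>h. (Jf (us p))\<^sup>2 * ws p * (- 2 * fst p) * fst h
     + (Jf (us p))\<^sup>2 * (ws p * Cw p - 1) * snd h)) (at p)"
proof -
  note d = coeff_derivs(1,3)[OF assms, THEN DERIV_compose_FDERIV[where g = us and x = p, OF _ us_derivative]]
  show ?thesis
    unfolding ts_def[abs_def]
    by (rule derivative_eq_intros d refl)+
      (simp add: fun_eq_iff ws_def algebra_simps power2_eq_square)
qed

text \<open>The determinant of the map from \<open>(\<xi>, w)\<close> to \<open>(t, z)\<close>. By
  \<open>compat\<close> it depends on \<open>u\<close> alone and does not degenerate at the centre,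
  although \<open>u\<close> is critical there.\<close>

lemma jacobian:
  "(Jf (us p))\<^sup>2 * ws p * (- 2 * fst p) * zw p - (Jf (us p))\<^sup>2 * (ws p * Cw p - 1) * zx p
    = - 2 * nf (us p) * Jf (us p) ^ 3"
proof -
  have "(Jf (us p))\<^sup>2 * ws p * (- 2 * fst p) * zw p - (Jf (us p))\<^sup>2 * (ws p * Cw p - 1) * zx p
    = 2 * Jf (us p) ^ 3 * (ws p * ((fst p)\<^sup>2 * Ms p) + (ws p * Cw p - 1) * (nf (us p) - hs p * ws p))"
    unfolding zx_def zw_def by (simp add: algebra_simps power2_eq_square power3_eq_cube)
  also have "ws p * ((fst p)\<^sup>2 * Ms p) + (ws p * Cw p - 1) * (nf (us p) - hs p * ws p) = - nf (us p)"
    unfolding compat[symmetric] by (simp add: algebra_simps)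
  finally show ?thesis by simp
qed

text \<open>The entries of the inverse Jacobian, with the common factors cancelled. \<open>c\<close>
  stands for \<open>ws * Cw - 1\<close> in the first identity and for \<open>hs * ws\<close> in the
  second.\<close>

lemma inverse_entries:
  fixes J n x M c m a b :: real
  assumes "J \<noteq> 0" "n \<noteq> 0"
  shows "(- J * x * M * a - J\<^sup>2 * c * b) / (- 2 * n * J ^ 3) = x * M / (2 * n * J\<^sup>2) * a + c / (2 * n * J) * b"
    and "(J\<^sup>2 * m * (- 2 * x) * b - - 2 * J * (n - c) * a) / (- 2 * n * J ^ 3)
      = (c - n) / (n * J\<^sup>2) * a + x * m / (n * J) * b"
  using assms by (simp_all add: divide_simps) (simp_all add: algebra_simps power2_eq_square power3_eq_cube)

text \<open>\<open>g\<close> inverts \<open>(\<xi>, w) \<mapsto> (t, z)\<close> near the centre; the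
  listed derivative contains the partial derivatives of \<open>\<xi>\<close> and \<open>w\<close>
  with respect to \<open>t\<close> and \<open>z\<close>.\<close>

lemma plane_coordinates:
  obtains V :: "(real \<times> real) set" and g :: "real \<times> real \<Rightarrow> real \<times> real" and e :: real
  where "open V" "(3 / 2, 0) \<in> V" "continuous_on V g" "0 < e" "e \<le> 1"
    "\<And>u. \<bar>u - 1\<bar> < e \<Longrightarrow> Jf u > 0" "\<And>u. \<bar>u - 1\<bar> < e \<Longrightarrow> nf u > 0"
    "\<And>u. 1 - e < u \<Longrightarrow> u < 1 \<Longrightarrow> bf u > 0"
    "us (g (3 / 2, 0)) = 1"
    "\<And>q. q \<in> V \<Longrightarrow> \<bar>us (g q) - 1\<bar> < e \<and> us (g q) \<le> 1"
    "\<And>q. q \<in> V \<Longrightarrow> us (g q) = 1 \<Longrightarrow> q = (3 / 2, 0)"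
    "\<And>q. q \<in> V \<Longrightarrow> ts (g q) = fst q"
    "\<And>q. q \<in> V \<Longrightarrow> (g has_derivative (\<lambda>h. let p = g q; J = Jf (us p); n = nf (us p) in
       (fst p * Ms p / (2 * n * J\<^sup>2) * fst h + (ws p * Cw p - 1) / (2 * n * J) * snd h,
        (hs p * ws p - n) / (n * J\<^sup>2) * fst h + fst p * ws p / (n * J) * snd h))) (at q)"
proof -
  obtain e where e: "0 < e" "e \<le> 1" "\<And>u. \<bar>u - 1\<bar> < e \<Longrightarrow> Jf u > 0"
    "\<And>u. \<bar>u - 1\<bar> < e \<Longrightarrow> nf u > 0" "\<And>u. 1 - e < u \<Longrightarrow> u < 1 \<Longrightarrow> bf u > 0"
    using coeff_range by blast
  let ?c = "(0, - (1 / 2)) :: real \<times> real"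
  have "isCont us ?c"
    using us_derivative has_derivative_continuous by blast
  then obtain r0 where r0: "r0 > 0" "\<And>p. dist p ?c < r0 \<Longrightarrow> \<bar>us p - 1\<bar> < e"
    using e(1) unfolding continuous_at_eps_delta us_center by (auto simp: dist_real_def)
  \<comment> \<open>The square of half-side \<open>r\<close> about the centre fits into the ball of
    radius \<open>r0\<close> because \<open>2 * r < r0\<close>, and \<open>r \<le> 1\<close> keeps
    \<open>w \<le> 1/2\<close> on it.\<close>
  define r where "r = min 1 (r0 / 3)"
  have r: "r > 0" "r \<le> 1" "2 * r < r0" using r0 by (auto simp: r_def)
  define S where "S = {- r..r} \<times> {- (1 / 2) - r..- (1 / 2) + r}"
  have S: "\<bar>us p - 1\<bar> < e \<and> snd p < 1" if "p \<in> S" for p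
  proof
    obtain x w where [simp]: "p = (x, w)" by force
    have "dist p ?c \<le> \<bar>x\<bar> + \<bar>w + 1 / 2\<bar>"
      by (simp add: dist_Pair_Pair dist_real_def sqrt_sum_squares_le_sum_abs)
    also have "\<dots> < r0" using that r by (auto simp: S_def abs_le_iff)
    finally show "\<bar>us p - 1\<bar> < e" by (rule r0)
    show "snd p < 1" using that r by (auto simp: S_def)
  qed
  then have S2: "\<bar>us p - 1\<bar> < 2" "Jf (us p) \<noteq> 0" "Jf (us p) > 0" "nf (us p) > 0" if "p \<in> S" for p
    using that e by fastforce+
  have cont: "continuous_on S (\<lambda>(x, w). zx (x, w))" "continuous_on S (\<lambda>(x, w). zw (x, w))"
    "continuous_on S (\<lambda>(x, w). zxw (x, w))"
    using continuous_on_coeffs[of S] S2 by auto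
  obtain z where z: "\<And>x w. - r < x \<Longrightarrow> x < r \<Longrightarrow> - (1 / 2) - r < w \<Longrightarrow> w < - (1 / 2) + r \<Longrightarrow>
      (z has_derivative (\<lambda>h. zx (x, w) * fst h + zw (x, w) * snd h)) (at (x, w))"
    by (rule poincare_rectangle[OF zx_zw_derivs cont[unfolded S_def]])
      (use S2 in \<open>auto simp: S_def\<close>)
  define U where "U = {- r<..<r} \<times> {- (1 / 2) - r<..<- (1 / 2) + r}"
  have U: "open U" "?c \<in> U" "U \<subseteq> S"
    using r by (auto simp: U_def S_def open_Times)
  define f where "f = (\<lambda>p. (ts p, z p - z ?c))"
  have f: "(f has_derivative (\<lambda>h. ((Jf (us p))\<^sup>2 * ws p * (- 2 * fst p) * fst h
     + (Jf (us p))\<^sup>2 * (ws p * Cw p - 1) * snd h, zx p * fst h + zw p * snd h))) (at p)" if "p \<in> U" for p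
  proof -
    have "(z has_derivative (\<lambda>h. zx p * fst h + zw p * snd h)) (at p)"
      using that z[of "fst p" "snd p"] by (auto simp: U_def)
    then have "((\<lambda>p. z p - z ?c) has_derivative (\<lambda>h. zx p * fst h + zw p * snd h)) (at p)"
      by (auto intro!: derivative_eq_intros)
    then show ?thesis unfolding f_def
      using subsetD[OF U(3) that] S2[of p] by (intro has_derivative_Pair ts_derivative) simp_all
  qed
  have US: "\<And>p. p \<in> U \<Longrightarrow> \<bar>us p - 1\<bar> < 2 \<and> Jf (us p) \<noteq> 0" using S2 U by blast
  note cc = continuous_on_coeffs[of U, OF US]
  have jac: "(Jf (us p))\<^sup>2 * ws p * (- 2 * fst p) * zw p - (Jf (us p))\<^sup>2 * (ws p * Cw p - 1) * zx p \<noteq> 0"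
    if "p \<in> U" for p
    unfolding jacobian using that S2[of p] U by auto
  \<comment> \<open>At the centre \<open>t = J(1)^2 (W(1) + 1/2) = 3/2\<close>; subtracting
    \<open>z ?c\<close> placed the circle at height 0.\<close>
  have fc: "f ?c = (3 / 2, 0)"
    unfolding f_def ts_def us_center by (simp add: coeff_one)
  obtain U' V g where g: "open U'" "U' \<subseteq> U" "?c \<in> U'" "open V" "f ?c \<in> V" "homeomorphism U' V f g"
    "\<And>y. y \<in> V \<Longrightarrow> (g has_derivative (\<lambda>h. let p = g y; D = (Jf (us p))\<^sup>2 * ws p * (- 2 * fst p) * zw p
          - (Jf (us p))\<^sup>2 * (ws p * Cw p - 1) * zx p
       in ((zw p * fst h - (Jf (us p))\<^sup>2 * (ws p * Cw p - 1) * snd h) / D,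
           ((Jf (us p))\<^sup>2 * ws p * (- 2 * fst p) * snd h - zx p * fst h) / D))) (at y)"
  proof (rule plane_inverse_function[OF U(1,2) f _ _ _ _ jac])
    show "continuous_on U (\<lambda>p. (Jf (us p))\<^sup>2 * ws p * (- 2 * fst p))"
      "continuous_on U (\<lambda>p. (Jf (us p))\<^sup>2 * (ws p * Cw p - 1))"
      by (intro continuous_intros cc; simp)+
  qed (use cc in auto)
  have gU: "g q \<in> S" "f (g q) = q" if "q \<in> V" for q
    using that g U by (auto simp: homeomorphism_def)
  have gc: "g (3 / 2, 0) = ?c"
    using g(3,6) fc by (metis homeomorphism_apply1)
  show ?thesis
  proof (rule that[OF g(4) _ homeomorphism_cont2[OF g(6)] e])
    show "(3 / 2, 0) \<in> V" using g(5) by (simp add: fc)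
    show "us (g (3 / 2, 0)) = 1" by (simp add: gc us_center)
    fix q assume q: "q \<in> V"
    show "\<bar>us (g q) - 1\<bar> < e \<and> us (g q) \<le> 1"
      using S[OF gU(1)[OF q]] us_le_one[of "g q"] by auto
    show "ts (g q) = fst q" using arg_cong[OF gU(2)[OF q], of fst] by (simp add: f_def)
    show "q = (3 / 2, 0)" if "us (g q) = 1"
      using that S[OF gU(1)[OF q]] us_eq_one_iff[of "g q"] gU(2)[OF q] fc by auto
    have n0: "Jf (us (g q)) \<noteq> 0" "nf (us (g q)) \<noteq> 0" using S2[OF gU(1)[OF q]] by auto
    have "(zw p * a - (Jf (us p))\<^sup>2 * (ws p * Cw p - 1) * b) / (- 2 * nf (us p) * Jf (us p) ^ 3)
        = fst p * Ms p / (2 * nf (us p) * (Jf (us p))\<^sup>2) * a + (ws p * Cw p - 1) / (2 * nf (us p) * Jf (us p)) * b"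
      "((Jf (us p))\<^sup>2 * ws p * (- 2 * fst p) * b - zx p * a) / (- 2 * nf (us p) * Jf (us p) ^ 3)
        = (hs p * ws p - nf (us p)) / (nf (us p) * (Jf (us p))\<^sup>2) * a + fst p * ws p / (nf (us p) * Jf (us p)) * b"
      if "p = g q" for a b p
      using n0 unfolding that zw_def zx_def by (intro inverse_entries; simp)+
    then show "(g has_derivative (\<lambda>h. let p = g q; J = Jf (us p); n = nf (us p) in
       (fst p * Ms p / (2 * n * J\<^sup>2) * fst h + (ws p * Cw p - 1) / (2 * n * J) * snd h,
        (hs p * ws p - n) / (n * J\<^sup>2) * fst h + fst p * ws p / (n * J) * snd h))) (at q)"
      using g(7)[OF q] unfolding Let_def jacobian by simp
  qed
qed

subsection \<open>Localisation of the flow\<close>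

text \<open>The partial derivatives are carried as explicit functions, so that the flow equations
  become algebraic identities between them.\<close>

definition plane_C1_on :: "(real \<times> real) set \<Rightarrow> (real \<times> real \<Rightarrow> real) \<Rightarrow> (real \<times> real \<Rightarrow> real) \<Rightarrow> (real \<times> real \<Rightarrow> real) \<Rightarrow> bool"
  where "plane_C1_on S f ft fz \<longleftrightarrow>
    (\<forall>q\<in>S. (f has_derivative (\<lambda>h. ft q * fst h + fz q * snd h)) (at q)) \<and> continuous_on S ft \<and> continuous_on S fz"

lemma plane_C1_on_subset: "plane_C1_on S f ft fz \<Longrightarrow> T \<subseteq> S \<Longrightarrow> plane_C1_on T f ft fz"
  unfolding plane_C1_on_def using continuous_on_subset by blast

lemma plane_C1_on_continuous: "plane_C1_on S f ft fz \<Longrightarrow> continuous_on S f"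
  unfolding plane_C1_on_def
  by (meson continuous_at_imp_continuous_on has_derivative_continuous)

lemma plane_C1_on_fst: "plane_C1_on S fst (\<lambda>_. 1) (\<lambda>_. 0)"
  unfolding plane_C1_on_def by (auto intro!: derivative_eq_intros)

lemma plane_C1_on_add:
  "plane_C1_on S f ft fz \<Longrightarrow> plane_C1_on S g gt gz \<Longrightarrow>
    plane_C1_on S (\<lambda>q. f q + g q) (\<lambda>q. ft q + gt q) (\<lambda>q. fz q + gz q)"
  unfolding plane_C1_on_def
  by (auto intro!: derivative_eq_intros continuous_intros simp: algebra_simps)

lemma plane_C1_on_mult:
  assumes f: "plane_C1_on S f ft fz" and g: "plane_C1_on S g gt gz"
  shows "plane_C1_on S (\<lambda>q. f q * g q) (\<lambda>q. ft q * g q + f q * gt q) (\<lambda>q. fz q * g q + f q * gz q)"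
  using assms plane_C1_on_continuous[OF f] plane_C1_on_continuous[OF g] unfolding plane_C1_on_def
  by (auto intro!: derivative_eq_intros continuous_intros simp: algebra_simps)

lemma plane_C1_on_compose:
  assumes f: "plane_C1_on S f ft fz"
    and \<phi>: "\<And>u. u \<in> I \<Longrightarrow> (\<phi> has_real_derivative \<phi>' u) (at u)" "continuous_on I \<phi>'" "f ` S \<subseteq> I"
  shows "plane_C1_on S (\<lambda>q. \<phi> (f q)) (\<lambda>q. \<phi>' (f q) * ft q) (\<lambda>q. \<phi>' (f q) * fz q)"
  unfolding plane_C1_on_def
proof (intro conjI ballI)
  have c: "continuous_on S (\<lambda>q. \<phi>' (f q))"
    by (rule continuous_on_compose2[OF \<phi>(2) plane_C1_on_continuous[OF f] \<phi>(3)])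
  then show "continuous_on S (\<lambda>q. \<phi>' (f q) * ft q)" "continuous_on S (\<lambda>q. \<phi>' (f q) * fz q)"
    using f unfolding plane_C1_on_def by (auto intro!: continuous_intros)
  fix q assume q: "q \<in> S"
  then have "(\<phi> has_real_derivative \<phi>' (f q)) (at (f q))" using \<phi> by blast
  moreover have "(f has_derivative (\<lambda>h. ft q * fst h + fz q * snd h)) (at q)"
    using f q unfolding plane_C1_on_def by blast
  ultimately show "((\<lambda>q. \<phi> (f q)) has_derivative (\<lambda>h. \<phi>' (f q) * ft q * fst h + \<phi>' (f q) * fz q * snd h)) (at q)"
    by (rule DERIV_compose_FDERIV[THEN has_derivative_eq_rhs]) (simp add: algebra_simps)
qed

text \<open>Extension by zero: \<open>S\<close> and the complement of \<open>C\<close> are an open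
  cover, and on their overlap the function and its partial derivatives vanish.\<close>

lemma plane_C1_on_glue:
  assumes f: "plane_C1_on S f ft fz" and S: "open S" "closed C" "C \<subseteq> S"
    and 0: "\<And>q. q \<in> S - C \<Longrightarrow> f q = 0 \<and> ft q = 0 \<and> fz q = 0"
  shows "plane_C1_on UNIV (\<lambda>q. if q \<in> S then f q else 0) (\<lambda>q. if q \<in> S then ft q else 0) (\<lambda>q. if q \<in> S then fz q else 0)"
proof -
  have U: "UNIV = S \<union> - C" "open (- C)" using S by auto
  have c: "continuous_on UNIV (\<lambda>q. if q \<in> S then g q else 0)"
    if "continuous_on S g" "\<And>q. q \<in> S - C \<Longrightarrow> g q = 0" for g :: "real \<times> real \<Rightarrow> real"
    unfolding U(1)
  proof (rule continuous_on_open_Un[OF S(1) U(2)])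
    show "continuous_on S (\<lambda>q. if q \<in> S then g q else 0)"
      using that(1) by (rule continuous_on_eq) auto
    show "continuous_on (- C) (\<lambda>q. if q \<in> S then g q else 0)"
      by (rule continuous_on_eq[of _ "\<lambda>_. 0"]) (use that(2) in auto)
  qed
  have "((\<lambda>q. if q \<in> S then f q else 0) has_derivative
     (\<lambda>h. (if q \<in> S then ft q else 0) * fst h + (if q \<in> S then fz q else 0) * snd h)) (at q)" for q
  proof (cases "q \<in> S")
    case True
    then have "(f has_derivative (\<lambda>h. ft q * fst h + fz q * snd h)) (at q)"
      using f unfolding plane_C1_on_def by blast
    then have "((\<lambda>q. if q \<in> S then f q else 0) has_derivative (\<lambda>h. ft q * fst h + fz q * snd h)) (at q)"
      by (rule has_derivative_transform_within_open[OF _ S(1) True]) auto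
    then show ?thesis using True by simp
  next
    case False
    then have q: "q \<in> - C" using S by auto
    have "((\<lambda>_. 0 :: real) has_derivative (\<lambda>_. 0)) (at q)" by (rule has_derivative_const)
    then have "((\<lambda>q. if q \<in> S then f q else 0) has_derivative (\<lambda>_. 0)) (at q)"
      by (rule has_derivative_transform_within_open[OF _ U(2) q]) (use 0 in auto)
    then show ?thesis using False by simp
  qed
  moreover have "continuous_on S ft" "continuous_on S fz" using f unfolding plane_C1_on_def by auto
  ultimately show ?thesis
    unfolding plane_C1_on_def using c[of ft] c[of fz] 0 by blast
qed

text \<open>Only \<open>s = 0\<close> is delicate; there the difference quotient is bounded by
  \<open>\<bar>y\<bar>\<close>.\<close>

lemma DERIV_max_0_square: "((\<lambda>s::real. (max 0 s)\<^sup>2) has_real_derivative 2 * max 0 s) (at s)"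
proof -
  consider "s > 0" | "s < 0" | "s = 0" by linarith
  then show ?thesis
  proof cases
    case 1
    have "((\<lambda>s. s\<^sup>2) has_real_derivative 2 * s) (at s)" by (auto intro!: derivative_eq_intros)
    then have "((\<lambda>s::real. (max 0 s)\<^sup>2) has_real_derivative 2 * s) (at s)"
      by (rule has_field_derivative_transform_within_open[where S = "{0<..}"]) (use 1 in auto)
    then show ?thesis using 1 by (simp add: max_def)
  next
    case 2
    have "((\<lambda>s. 0) has_real_derivative 0) (at s)" by simp
    then have "((\<lambda>s::real. (max 0 s)\<^sup>2) has_real_derivative 0) (at s)"
      by (rule has_field_derivative_transform_within_open[where S = "{..<0}"]) (use 2 in auto)
    then show ?thesis using 2 by (simp add: max_def)
  next
    case 3
    have "((\<lambda>y. ((max 0 y)\<^sup>2 - (max 0 0)\<^sup>2) / (y - 0)) \<longlongrightarrow> 0) (at (0::real))"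
    proof (rule Lim_null_comparison[OF always_eventually])
      show "\<forall>y::real. norm (((max 0 y)\<^sup>2 - (max 0 0)\<^sup>2) / (y - 0)) \<le> \<bar>y\<bar>"
        by (auto simp: max_def power2_eq_square)
      show "((\<lambda>y::real. \<bar>y\<bar>) \<longlongrightarrow> 0) (at 0)" by (auto intro!: tendsto_eq_intros)
    qed
    then show ?thesis using 3 by (simp add: has_field_derivative_iff)
  qed
qed

text \<open>The squared positive part of \<open>(u - a) * (b - u)\<close> is of class C^1, the
  regularity required of the velocity.\<close>

lemma bump_exists:
  fixes a b :: real
  assumes "a < b"
  obtains \<alpha> \<alpha>' :: "real \<Rightarrow> real" where
    "\<And>u. (\<alpha> has_real_derivative \<alpha>' u) (at u)" "continuous_on UNIV \<alpha>'"
    "\<And>u. u \<notin> {a..b} \<Longrightarrow> \<alpha> u = 0 \<and> \<alpha>' u = 0" "\<And>u. a < u \<Longrightarrow> u < b \<Longrightarrow> \<alpha> u > 0"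
proof
  let ?\<alpha> = "\<lambda>u. (max 0 ((u - a) * (b - u)))\<^sup>2"
  let ?\<alpha>' = "\<lambda>u. 2 * max 0 ((u - a) * (b - u)) * (a + b - 2 * u)"
  have "((\<lambda>u. (u - a) * (b - u)) has_real_derivative (a + b - 2 * u)) (at u)" for u
    by (auto intro!: derivative_eq_intros)
  from DERIV_chain2[OF DERIV_max_0_square this]
  show "(?\<alpha> has_real_derivative ?\<alpha>' u) (at u)" for u .
  show "continuous_on UNIV ?\<alpha>'" by (intro continuous_intros)
  show "?\<alpha> u = 0 \<and> ?\<alpha>' u = 0" if "u \<notin> {a..b}" for u
  proof -
    have "(u - a) * (b - u) \<le> 0"
      using that assms by (auto simp: mult_le_0_iff)
    then show ?thesis by (simp add: max_def)
  qed
  show "?\<alpha> u > 0" if "a < u" "u < b" for u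
    using that by (simp add: max_def)
qed

text \<open>
  With \<open>D = v \<cdot> \<nabla>\<close> one has \<open>Du = 0\<close>, so no derivative of a function of \<open>u\<close> survives in the Euler equations;
  these identities are the intermediate facts \<open>eu\<close>, \<open>ex\<close> and \<open>ew\<close>.
\<close>

lemma flow_algebra:
  fixes J n t x w u h m C M W W1 k b al al' si si' :: real
  assumes pos: "J > 0" "n > 0" "t > 0"
    and comp: "C * (h * m - n) - h = x\<^sup>2 * M" and M: "M = W1 + 2 * m - h * k"
    and t: "t = J\<^sup>2 * (W - w)" and h: "h = w + W / 2" and x: "x\<^sup>2 = 4 * w ^ 3 - 3 * w - u"
    and b: "b = u + 3 * W - 4 * W ^ 3" and C: "C = 12 * w\<^sup>2 - 3" and si: "si\<^sup>2 = b"
    and ut: "ut = h / (n * J\<^sup>2)" and uz: "uz = x / (n * J)"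
    and xt: "xt = x * M / (2 * n * J\<^sup>2)" and xz: "xz = (m * C - 1) / (2 * n * J)"
    and wt: "wt = (h * m - n) / (n * J\<^sup>2)" and wz: "wz = x * m / (n * J)"
    and A: "A = al * x / t" "At = (al' * ut * x + al * xt) / t - al * x / t\<^sup>2" "Az = (al' * uz * x + al * xz) / t"
    and B: "B = al * si / t" "Bt = (al' * ut * si + al * (si' * ut)) / t - al * si / t\<^sup>2"
      "Bz = (al' * uz * si + al * (si' * uz)) / t"
    and K: "K = 2 * al * h / J" "Kt = (2 * al' / J - al * k / J) * ut * h + 2 * al / J * (wt + W1 * ut / 2)"
      "Kz = (2 * al' / J - al * k / J) * uz * h + 2 * al / J * (wz + W1 * uz / 2)"
    and Q: "Qt = - 4 * al\<^sup>2 * n / J\<^sup>2 * ut" "Qz = - 4 * al\<^sup>2 * n / J\<^sup>2 * uz"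
  shows "2 * A + 2 * t * At = Kz"
    and "- 2 * t * A * Bt + K * Bz = 2 * A * B"
    and "- 2 * t * A * At + K * Az - A\<^sup>2 + B\<^sup>2 = 2 * Qt"
    and "- 2 * t * A * Kt + K * Kz = - Qz"
proof -
  have nz: "J \<noteq> 0" "n \<noteq> 0" "t \<noteq> 0" using pos by auto
  \<comment> \<open>The left side is twice the t-derivative of \<open>t A = al x\<close>.\<close>
  have "2 * A + 2 * t * At = 2 * (al' * ut * x + al * xt)"
    unfolding A using nz by (simp add: field_simps power2_eq_square)
  also have "\<dots> = Kz"
    unfolding K ut uz xt wz M using nz by (simp add: field_simps power2_eq_square)
  finally show "2 * A + 2 * t * At = Kz" .
  have D: "h * uz = J * x * ut"
    unfolding ut uz using nz by (simp add: field_simps power2_eq_square)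
  have tA: "t * A = al * x" unfolding A using nz by simp
  have eu: "- 2 * x * ut + 2 * h / J * uz = 0"
    using D nz by (simp add: field_simps)
  have "- 2 * t * A * Bt + K * Bz = al * (al' * si + al * si') / t * (- 2 * x * ut + 2 * h / J * uz) + 2 * al * x * (al * si / t\<^sup>2)"
    unfolding B K(1) mult.assoc tA using nz by (simp add: field_simps power2_eq_square)
  then show "- 2 * t * A * Bt + K * Bz = 2 * A * B"
    unfolding eu A B(1) using nz by (simp add: field_simps power2_eq_square)
  have ex: "- 2 * x * xt + 2 * h / J * xz = C / J\<^sup>2"
  proof -
    have "- 2 * x * xt + 2 * h / J * xz = (C * (h * m) - h - x\<^sup>2 * M) / (n * J\<^sup>2)"
      unfolding xt xz using nz by (simp add: field_simps power2_eq_square)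
    also have "C * (h * m) - h - x\<^sup>2 * M = C * n" using comp by (simp add: algebra_simps)
    finally show ?thesis using nz by simp
  qed
  have "- 2 * t * A * At + K * Az = al / t * (al' * x * (- 2 * x * ut + 2 * h / J * uz)
     + al * (- 2 * x * xt + 2 * h / J * xz)) + 2 * al\<^sup>2 * x\<^sup>2 / t\<^sup>2"
    unfolding A(2,3) K(1) mult.assoc tA using nz by (simp add: field_simps power2_eq_square)
  also have "\<dots> = al / t * (al * (C / J\<^sup>2)) + 2 * al\<^sup>2 * x\<^sup>2 / t\<^sup>2"
    unfolding eu ex by simp
  finally have "- 2 * t * A * At + K * Az - A\<^sup>2 + B\<^sup>2
     = al / t * (al * (C / J\<^sup>2)) + 2 * al\<^sup>2 * x\<^sup>2 / t\<^sup>2 - (al * x / t)\<^sup>2 + (al * si / t)\<^sup>2"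
    unfolding A(1)[symmetric] B(1)[symmetric] by simp
  also have "\<dots> = al\<^sup>2 * (C * t / J\<^sup>2 + x\<^sup>2 + b) / t\<^sup>2"
    unfolding si[symmetric] using nz by (simp add: field_simps power2_eq_square)
  \<comment> \<open>This explains the choice of \<open>b\<close>: the cubic in \<open>w\<close> gets
    a double root at \<open>w = W\<close>, which cancels against \<open>t^2\<close>, and the
    remaining factor \<open>h\<close> is proportional to \<open>ut\<close> on each level
    curve.\<close>
  also have "C * t / J\<^sup>2 + x\<^sup>2 + b = - 8 * (W - w)\<^sup>2 * h"
    unfolding C t x b h using nz by (simp add: field_simps power2_eq_square power3_eq_cube)
  also have "al\<^sup>2 * (- 8 * (W - w)\<^sup>2 * h) / t\<^sup>2 = - 8 * al\<^sup>2 * h / J ^ 4"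
  proof -
    have "W - w \<noteq> 0" using t nz by auto
    then show ?thesis unfolding t using nz by (simp add: divide_simps power_mult_distrib)
  qed
  also have "\<dots> = 2 * Qt"
    unfolding Q ut using nz by (simp add: field_simps power2_eq_square power4_eq_xxxx)
  finally show "- 2 * t * A * At + K * Az - A\<^sup>2 + B\<^sup>2 = 2 * Qt" .
  have ew: "- 2 * x * wt + 2 * h / J * wz = 2 * x / J\<^sup>2"
    unfolding wt wz using nz by (simp add: field_simps power2_eq_square)
  have "- 2 * t * A * Kt + K * Kz = al * (((2 * al' / J - al * k / J) * h + al / J * W1) * (- 2 * x * ut + 2 * h / J * uz)
      + 2 * al / J * (- 2 * x * wt + 2 * h / J * wz))"
    unfolding K mult.assoc tA using nz by (simp add: field_simps)
  also have "\<dots> = al * (2 * al / J * (2 * x / J\<^sup>2))"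
    unfolding eu ew by simp
  also have "\<dots> = - Qz"
    unfolding Q uz using nz by (simp add: field_simps power2_eq_square)
  finally show "- 2 * t * A * Kt + K * Kz = - Qz" .
qed


text \<open>In the variables \<open>t = r^2\<close> and \<open>z\<close>, the radial, azimuthal and
  axial velocities are \<open>-r A\<close>, \<open>r B\<close>, \<open>K\<close>, and
  \<open>Q\<close> is pressure over density. The four identities are the divergence condition and
  the azimuthal, radial and axial Euler equations. The support avoids the axis.\<close>

lemma compact_axisymmetric_flow:
  obtains A At Az B Bt Bz K Kt Kz Q Qt Qz :: "real \<times> real \<Rightarrow> real" where
    "plane_C1_on UNIV A At Az" "plane_C1_on UNIV B Bt Bz" "plane_C1_on UNIV K Kt Kz" "plane_C1_on UNIV Q Qt Qz"
    "\<And>q. 2 * A q + 2 * fst q * At q = Kz q"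
    "\<And>q. - 2 * fst q * A q * Bt q + K q * Bz q = 2 * A q * B q"
    "\<And>q. - 2 * fst q * A q * At q + K q * Az q - (A q)\<^sup>2 + (B q)\<^sup>2 = 2 * Qt q"
    "\<And>q. - 2 * fst q * A q * Kt q + K q * Kz q = - Qz q"
    "\<And>q. fst q \<notin> {1 / 2..5 / 2} \<or> snd q \<notin> {- 1..1} \<Longrightarrow> A q = 0 \<and> B q = 0 \<and> K q = 0 \<and> Q q = 0"
    "\<exists>q. B q \<noteq> 0"
proof -
  obtain V g e where V: "open V" "(3 / 2, 0) \<in> V" "continuous_on V g" "0 < e" "e \<le> (1::real)"
    and J_pos: "\<And>u. \<bar>u - 1\<bar> < e \<Longrightarrow> Jf u > 0" and n_pos: "\<And>u. \<bar>u - 1\<bar> < e \<Longrightarrow> nf u > 0"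
    and b_pos: "\<And>u. 1 - e < u \<Longrightarrow> u < 1 \<Longrightarrow> bf u > 0"
    and center: "us (g (3 / 2, 0)) = 1"
    and range: "\<And>q. q \<in> V \<Longrightarrow> \<bar>us (g q) - 1\<bar> < e \<and> us (g q) \<le> 1"
    and center_only: "\<And>q. q \<in> V \<Longrightarrow> us (g q) = 1 \<Longrightarrow> q = (3 / 2, 0)"
    and ts_g: "\<And>q. q \<in> V \<Longrightarrow> ts (g q) = fst q"
    and deriv_g: "\<And>q. q \<in> V \<Longrightarrow> (g has_derivative (\<lambda>h. let p = g q; J = Jf (us p); n = nf (us p) in
       (fst p * Ms p / (2 * n * J\<^sup>2) * fst h + (ws p * Cw p - 1) / (2 * n * J) * snd h,
        (hs p * ws p - n) / (n * J\<^sup>2) * fst h + fst p * ws p / (n * J) * snd h))) (at q)"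
    by (rule plane_coordinates) blast
  define u where "u = (\<lambda>q. us (g q))"
  define xi where "xi = (\<lambda>q. fst (g q))"
  define w where "w = (\<lambda>q. snd (g q))"
  define J where "J = (\<lambda>q. Jf (u q))"
  define n where "n = (\<lambda>q. nf (u q))"
  define h where "h = (\<lambda>q. hs (g q))"
  define m where "m = (\<lambda>q. ws (g q))"
  define M where "M = (\<lambda>q. Ms (g q))"
  define C where "C = (\<lambda>q. Cw (g q))"
  define xt where "xt = (\<lambda>q. xi q * M q / (2 * n q * (J q)\<^sup>2))"
  define xz where "xz = (\<lambda>q. (m q * C q - 1) / (2 * n q * J q))"
  define wt where "wt = (\<lambda>q. (h q * m q - n q) / (n q * (J q)\<^sup>2))"
  define wz where "wz = (\<lambda>q. xi q * m q / (n q * J q))"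
  define ut where "ut = (\<lambda>q. h q / (n q * (J q)\<^sup>2))"
  define uz where "uz = (\<lambda>q. xi q / (n q * J q))"
  note defs = u_def xi_def w_def J_def n_def h_def m_def M_def C_def
  have pos: "J q > 0" "n q > 0" "J q \<noteq> 0" "n q \<noteq> 0" "\<bar>u q - 1\<bar> < 2" if "q \<in> V" for q
    using range[OF that] V(5) J_pos[of "u q"] n_pos[of "u q"] by (auto simp: J_def n_def u_def)
  have gc: "continuous_on V (\<lambda>q. f (g q))" if "continuous_on (g ` V) f" for f :: "real \<times> real \<Rightarrow> real"
    using that V(3) by (rule continuous_on_compose2) auto
  have coeffs: "p \<in> g ` V \<Longrightarrow> \<bar>us p - 1\<bar> < 2 \<and> Jf (us p) \<noteq> 0" for p
    using pos by (auto simp: defs)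
  note cc = continuous_on_coeffs[of "g ` V", OF coeffs]
  have cont: "continuous_on V J" "continuous_on V n" "continuous_on V h" "continuous_on V m"
    "continuous_on V M" "continuous_on V C" "continuous_on V xi"
    unfolding defs using V(3) by (auto intro!: gc cc continuous_intros)
  have cont2: "continuous_on V ut" "continuous_on V uz" "continuous_on V xt" "continuous_on V xz"
    "continuous_on V wt" "continuous_on V wz"
    unfolding ut_def uz_def xt_def xz_def wt_def wz_def
    by (intro continuous_intros cont; use pos in force)+
  have dg: "(g has_derivative (\<lambda>h. (xt q * fst h + xz q * snd h, wt q * fst h + wz q * snd h))) (at q)"
    if "q \<in> V" for q
    using deriv_g[OF that] by (simp add: Let_def xt_def xz_def wt_def wz_def defs)
  have comp: "C q * (h q * m q - n q) - h q = (xi q)\<^sup>2 * M q" for q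
    using compat[of "g q"] by (simp add: defs)
  have xi_C1: "plane_C1_on V xi xt xz" and w_C1: "plane_C1_on V w wt wz"
    using has_derivative_fst[OF dg] has_derivative_snd[OF dg] cont2
    by (auto simp: plane_C1_on_def xi_def w_def)
  have u_C1: "plane_C1_on V u ut uz"
    unfolding plane_C1_on_def
  proof (intro conjI ballI cont2)
    fix q assume q: "q \<in> V"
    have "C q * wt q - 2 * xi q * xt q = (C q * (h q * m q - n q) - (xi q)\<^sup>2 * M q) / (n q * (J q)\<^sup>2)"
      unfolding wt_def xt_def using pos[OF q] by (simp add: field_simps power2_eq_square)
    also have "\<dots> = ut q" unfolding comp[symmetric] ut_def by simp
    finally have t: "C q * wt q - 2 * xi q * xt q = ut q" .
    have z: "C q * wz q - 2 * xi q * xz q = uz q"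
      unfolding wz_def xz_def uz_def using pos[OF q] by (simp add: field_simps)
    show "(u has_derivative (\<lambda>h. ut q * fst h + uz q * snd h)) (at q)"
      unfolding u_def
      by (rule has_derivative_compose[OF dg[OF q] us_derivative, THEN has_derivative_eq_rhs])
        (simp add: fun_eq_iff t[symmetric] z[symmetric] C_def xi_def algebra_simps)
  qed
  have u_cont: "continuous_on V u" using u_C1 by (rule plane_C1_on_continuous)

  obtain \<delta>0 where "\<delta>0 > 0" "ball (3 / 2, 0) \<delta>0 \<subseteq> V"
    using V(1,2) open_contains_ball by blast
  \<comment> \<open>The square of half-side \<open>\<delta>\<close> lies in the ball of radius
    \<open>\<delta>0\<close> and in the support window of the statement.\<close>
  define \<delta> where "\<delta> = min 1 (\<delta>0 / 3)"
  have \<delta>: "0 < \<delta>" "\<delta> \<le> 1" "2 * \<delta> < \<delta>0" using \<open>\<delta>0 > 0\<close> by (auto simp: \<delta>_def)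
  define D where "D = cbox (3 / 2 - \<delta>, - \<delta>) (3 / 2 + \<delta>, \<delta>)"
  define D' where "D' = box (3 / 2 - \<delta>, - \<delta>) (3 / 2 + \<delta>, \<delta>)"
  have D_eq: "D = {3 / 2 - \<delta>..3 / 2 + \<delta>} \<times> {- \<delta>..\<delta>}" "D' = {3 / 2 - \<delta><..<3 / 2 + \<delta>} \<times> {- \<delta><..<\<delta>}"
    by (auto simp: D_def D'_def mem_box Basis_prod_def)
  have DV: "D \<subseteq> V"
  proof
    fix q assume q: "q \<in> D"
    obtain a b where [simp]: "q = (a, b)" by force
    have "dist (3 / 2, 0) q \<le> \<bar>3 / 2 - a\<bar> + \<bar>b\<bar>"
      using sqrt_sum_squares_le_sum_abs[of "3 / 2 - a" b] by (simp add: dist_Pair_Pair dist_real_def)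
    also have "\<dots> < \<delta>0" using q \<delta> by (auto simp: D_eq abs_le_iff)
    finally show "q \<in> V" using \<open>ball (3 / 2, 0) \<delta>0 \<subseteq> V\<close> by auto
  qed
  have compact_D: "compact D" by (simp add: D_def compact_cbox)
  \<comment> \<open>\<open>u\<close> equals 1 only at the centre, which is interior, so its maximum
    \<open>u q1\<close> over the boundary of the square is below 1. Level sets in \<open>D\<close>
    above that value stay away from the boundary.\<close>
  have "compact (D - D')"
    using compact_D unfolding D'_def by (intro compact_diff open_box)
  moreover have "(3 / 2 + \<delta>, 0) \<in> D - D'" using \<delta> by (auto simp: D_eq)
  ultimately obtain q1 where q1: "q1 \<in> D - D'" "\<And>q. q \<in> D - D' \<Longrightarrow> u q \<le> u q1"
    using continuous_attains_sup[of "D - D'" u] continuous_on_subset[OF u_cont] DV by blast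
  obtain q0 where q0: "q0 \<in> D" "\<And>q. q \<in> D \<Longrightarrow> u q0 \<le> u q"
    using continuous_attains_inf[of D u] continuous_on_subset[OF u_cont DV] compact_D q1 by blast
  have "(3 / 2, 0) \<in> D'" using \<delta> by (auto simp: D_eq)
  then have "u q1 < 1"
    using range[of q1] center_only[of q1] q1(1) DV by (force simp: u_def)
  \<comment> \<open>Between \<open>1 - e\<close> and the minimum of \<open>u\<close> on
    \<open>D\<close>: a lower limit of integration for the pressure, inside the range where
    \<open>Jf\<close> is positive.\<close>
  define c where "c = (u q0 + (1 - e)) / 2"
  have c: "1 - e < c" "c < u q0" "u q0 \<le> u q1"
    using range[of q0] q0 q1 DV by (auto simp: c_def u_def abs_less_iff)
  \<comment> \<open>The bump interval is the middle third between the boundary maximum and 1, away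
    from both the boundary and the centre.\<close>
  define a where "a = u q1 + (1 - u q1) / 3"
  define b where "b = u q1 + 2 * (1 - u q1) / 3"
  have ab: "u q1 < a" "a < b" "b < 1" using \<open>u q1 < 1\<close> by (auto simp: a_def b_def field_simps)
  obtain \<alpha> \<alpha>' where \<alpha>: "\<And>u. (\<alpha> has_real_derivative \<alpha>' u) (at u)" "continuous_on UNIV \<alpha>'"
    "\<And>u. u \<notin> {a..b} \<Longrightarrow> \<alpha> u = 0 \<and> \<alpha>' u = 0" "\<And>u. a < u \<Longrightarrow> u < b \<Longrightarrow> \<alpha> u > 0"
    using bump_exists[OF ab(2)] by metis

  \<comment> \<open>The centre is left out because \<open>bf\<close> vanishes at
    \<open>u = 1\<close>, where its square root need not be differentiable.\<close>
  define S where "S = D' \<inter> u -` {..<1}"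
  define Z where "Z = D \<inter> u -` {a..b}"
  have DD: "D' \<subseteq> D" "S \<subseteq> D'" by (auto simp: D_eq S_def)
  have open_S: "open S" unfolding S_def D'_def
    by (rule continuous_open_preimage[OF continuous_on_subset[OF u_cont]])
      (use DD DV in \<open>auto simp: D'_def open_box\<close>)
  have closed_Z: "closed Z" unfolding Z_def
    by (rule continuous_closed_preimage[OF continuous_on_subset[OF u_cont DV] compact_imp_closed[OF compact_D]]) simp
  have ZS: "Z \<subseteq> S" using q1(2) ab by (fastforce simp: Z_def S_def)
  have SV: "S \<subseteq> V" using DD DV by auto
  have S_range: "1 - e < u q \<and> u q < 1 \<and> fst q > 0" if "q \<in> S" for q
    using that range[of q] SV \<delta> by (auto simp: S_def D_eq u_def)

  define I where "I = {1 - e<..<1}"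
  have uI: "u ` S \<subseteq> I" using S_range by (auto simp: I_def)
  have I: "\<bar>s - 1\<bar> < 2" "Jf s \<noteq> 0" "bf s > 0" if "s \<in> I" for s
    using that V(5) J_pos[of s] b_pos[of s] by (auto simp: I_def)
  have I_cont: "continuous_on I Jf" "continuous_on I kf" "continuous_on I Wf" "continuous_on I Wd"
    using I by (auto intro!: continuous_at_imp_continuous_on intro: coeff_derivs(1-5)[THEN DERIV_isCont])
  have \<alpha>_cont: "continuous_on T \<alpha>" "continuous_on T \<alpha>'" for T
    using DERIV_isCont[OF \<alpha>(1)] continuous_on_subset[OF \<alpha>(2)] by (auto intro!: continuous_at_imp_continuous_on)
  have b_cont: "continuous_on I bf" unfolding bf_def[abs_def] by (intro continuous_intros I_cont)
  define \<sigma>' where "\<sigma>' = (\<lambda>s. (1 + 3 * Wd s - 12 * (Wf s)\<^sup>2 * Wd s) / (2 * sqrt (bf s)))"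
  have \<sigma>: "((\<lambda>s. sqrt (bf s)) has_real_derivative \<sigma>' s) (at s)" if "s \<in> I" for s
  proof -
    have "(bf has_real_derivative (1 + 3 * Wd s - 12 * (Wf s)\<^sup>2 * Wd s)) (at s)"
      unfolding bf_def[abs_def] using DERIV_Wf[OF I(1,2)[OF that]]
      by (auto intro!: derivative_eq_intros)
    from DERIV_chain2[where g = bf and x = s, OF DERIV_real_sqrt[OF I(3)[OF that]] this] show ?thesis
      unfolding \<sigma>'_def by (rule DERIV_cong) (simp add: field_simps)
  qed
  have \<sigma>'_cont: "continuous_on I \<sigma>'"
    unfolding \<sigma>'_def using I(3) by (intro continuous_intros I_cont b_cont) force
  define \<kappa>' where "\<kappa>' = (\<lambda>s. 2 * \<alpha>' s / Jf s - \<alpha> s * kf s / Jf s)"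
  have \<kappa>: "((\<lambda>s. 2 * \<alpha> s / Jf s) has_real_derivative \<kappa>' s) (at s)" if "s \<in> I" for s
    using DERIV_Jf[OF I(1,2)[OF that]] \<alpha>(1)[of s] I(2)[OF that]
    by (auto intro!: derivative_eq_intros simp: \<kappa>'_def field_simps)
  have \<kappa>'_cont: "continuous_on I \<kappa>'"
    unfolding \<kappa>'_def using I(2) by (intro continuous_intros I_cont \<alpha>_cont) auto

  note uS = plane_C1_on_subset[OF u_C1 SV] and xiS = plane_C1_on_subset[OF xi_C1 SV]
    and wS = plane_C1_on_subset[OF w_C1 SV]
  have \<alpha>S: "plane_C1_on S (\<lambda>q. \<alpha> (u q)) (\<lambda>q. \<alpha>' (u q) * ut q) (\<lambda>q. \<alpha>' (u q) * uz q)"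
    by (rule plane_C1_on_compose[where I = UNIV, OF uS \<alpha>(1) \<alpha>_cont(2)]) simp
  have tS: "plane_C1_on S (\<lambda>q. inverse (fst q)) (\<lambda>q. - ((inverse (fst q))\<^sup>2) * 1) (\<lambda>q. - ((inverse (fst q))\<^sup>2) * 0)"
    by (rule plane_C1_on_compose[OF plane_C1_on_fst, where I = "{0<..}"])
      (use S_range in \<open>auto intro!: derivative_eq_intros continuous_intros simp: power2_eq_square\<close>)
  note \<sigma>S = plane_C1_on_compose[OF uS \<sigma> \<sigma>'_cont uI] and \<kappa>S = plane_C1_on_compose[OF uS \<kappa> \<kappa>'_cont uI]
  have WS: "plane_C1_on S (\<lambda>q. Wf (u q) / 2) (\<lambda>q. Wd (u q) / 2 * ut q) (\<lambda>q. Wd (u q) / 2 * uz q)"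
    by (rule plane_C1_on_compose[OF uS _ _ uI])
      (use I DERIV_Wf in \<open>auto intro!: derivative_eq_intros continuous_intros I_cont\<close>)
  define A where "A = (\<lambda>q. \<alpha> (u q) * xi q * inverse (fst q))"
  define At where "At = (\<lambda>q. (\<alpha>' (u q) * ut q * xi q + \<alpha> (u q) * xt q) * inverse (fst q)
    + \<alpha> (u q) * xi q * (- ((inverse (fst q))\<^sup>2) * 1))"
  define Az where "Az = (\<lambda>q. (\<alpha>' (u q) * uz q * xi q + \<alpha> (u q) * xz q) * inverse (fst q)
    + \<alpha> (u q) * xi q * (- ((inverse (fst q))\<^sup>2) * 0))"
  define B where "B = (\<lambda>q. \<alpha> (u q) * sqrt (bf (u q)) * inverse (fst q))"
  define Bt where "Bt = (\<lambda>q. (\<alpha>' (u q) * ut q * sqrt (bf (u q)) + \<alpha> (u q) * (\<sigma>' (u q) * ut q)) * inverse (fst q)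
    + \<alpha> (u q) * sqrt (bf (u q)) * (- ((inverse (fst q))\<^sup>2) * 1))"
  define Bz where "Bz = (\<lambda>q. (\<alpha>' (u q) * uz q * sqrt (bf (u q)) + \<alpha> (u q) * (\<sigma>' (u q) * uz q)) * inverse (fst q)
    + \<alpha> (u q) * sqrt (bf (u q)) * (- ((inverse (fst q))\<^sup>2) * 0))"
  define K where "K = (\<lambda>q. 2 * \<alpha> (u q) / Jf (u q) * (w q + Wf (u q) / 2))"
  define Kt where "Kt = (\<lambda>q. \<kappa>' (u q) * ut q * (w q + Wf (u q) / 2)
    + 2 * \<alpha> (u q) / Jf (u q) * (wt q + Wd (u q) / 2 * ut q))"
  define Kz where "Kz = (\<lambda>q. \<kappa>' (u q) * uz q * (w q + Wf (u q) / 2)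
    + 2 * \<alpha> (u q) / Jf (u q) * (wz q + Wd (u q) / 2 * uz q))"
  have AS: "plane_C1_on S A At Az"
    unfolding A_def At_def Az_def by (rule plane_C1_on_mult[OF plane_C1_on_mult[OF \<alpha>S xiS] tS])
  have BS: "plane_C1_on S B Bt Bz"
    unfolding B_def Bt_def Bz_def by (rule plane_C1_on_mult[OF plane_C1_on_mult[OF \<alpha>S \<sigma>S] tS])
  have KS: "plane_C1_on S K Kt Kz"
    unfolding K_def Kt_def Kz_def by (rule plane_C1_on_mult[OF \<kappa>S plane_C1_on_add[OF wS WS]])
  have out: "\<alpha> (u q) = 0 \<and> \<alpha>' (u q) = 0" if "q \<in> S - Z" for q
    using that DD \<alpha>(3)[of "u q"] by (auto simp: Z_def)
  have A_out: "A q = 0 \<and> At q = 0 \<and> Az q = 0" and B_out: "B q = 0 \<and> Bt q = 0 \<and> Bz q = 0"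
    and K_out: "K q = 0 \<and> Kt q = 0 \<and> Kz q = 0" if "q \<in> S - Z" for q
    using out[OF that] by (simp_all add: A_def At_def Az_def B_def Bt_def Bz_def K_def Kt_def Kz_def \<kappa>'_def)
  note A_glue = plane_C1_on_glue[OF AS open_S closed_Z ZS A_out]
    and B_glue = plane_C1_on_glue[OF BS open_S closed_Z ZS B_out]
    and K_glue = plane_C1_on_glue[OF KS open_S closed_Z ZS K_out]

  \<comment> \<open>The pressure is \<open>F(u)\<close> with \<open>F' = \<phi>\<close>. It is
    constant for \<open>u\<close> above \<open>b\<close>, hence around the centre, so it is glued
    along the whole square \<open>D'\<close> and not along \<open>S\<close>.\<close>
  define \<phi> where "\<phi> = (\<lambda>s. - 4 * (\<alpha> s)\<^sup>2 * nf s / (Jf s)\<^sup>2)"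
  define F where "F = (\<lambda>s. integral {c..s} \<phi>)"
  \<comment> \<open>An upper end beyond 1, so that \<open>F\<close> is differentiable at the central
    value too.\<close>
  define d where "d = 1 + e / 2"
  have cd: "\<bar>s - 1\<bar> < 2 \<and> Jf s \<noteq> 0" if "s \<in> {c..d}" for s
  proof -
    have "\<bar>s - 1\<bar> < e" using that V(4) c(1) by (auto simp: d_def abs_less_iff)
    then show ?thesis using J_pos[of s] V(5) by auto
  qed
  have "continuous_on {c..d} Jf" "continuous_on {c..d} nf"
    using cd by (auto intro!: continuous_at_imp_continuous_on intro: coeff_derivs(1-5)[THEN DERIV_isCont])
  then have \<phi>_cont: "continuous_on {c..d} \<phi>"
    unfolding \<phi>_def using cd by (intro continuous_intros \<alpha>_cont) auto
  have F: "(F has_real_derivative \<phi> s) (at s)" if "s \<in> {c<..<d}" for s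
  proof -
    have "(F has_real_derivative \<phi> s) (at s within {c..d})"
      unfolding F_def by (rule integral_has_real_derivative[OF \<phi>_cont]) (use that in auto)
    then show ?thesis using that by (simp add: at_within_Icc_at)
  qed
  have \<phi>0: "\<phi> s = 0" if "s \<notin> {a..b}" for s using \<alpha>(3)[OF that] by (simp add: \<phi>_def)
  have F0: "F s = 0" if "s < a" for s
    unfolding F_def by (rule integral_unique, rule has_integral_is_0) (use that \<phi>0 in auto)
  have uD: "u ` D' \<subseteq> {c<..<d}"
  proof clarify
    fix q assume "q \<in> D'"
    then have "q \<in> D" "q \<in> V" using DD DV by auto
    then show "u q \<in> {c<..<d}"
      using q0(2)[of q] c range[of q] V(4) by (auto simp: d_def u_def)
  qed
  have D'V: "D' \<subseteq> V" using DD DV by auto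
  have "open D'" by (simp add: D'_def open_box)
  have closed_Z': "closed (D \<inter> u -` {a..})"
    by (rule continuous_closed_preimage[OF continuous_on_subset[OF u_cont DV] compact_imp_closed[OF compact_D]]) simp
  have ZS': "D \<inter> u -` {a..} \<subseteq> D'" using q1(2) ab by fastforce
  have QS: "plane_C1_on D' (\<lambda>q. F (u q)) (\<lambda>q. \<phi> (u q) * ut q) (\<lambda>q. \<phi> (u q) * uz q)"
    by (rule plane_C1_on_compose[OF plane_C1_on_subset[OF u_C1 D'V] F continuous_on_subset[OF \<phi>_cont] uD]) auto
  have outQ: "F (u q) = 0 \<and> \<phi> (u q) * ut q = 0 \<and> \<phi> (u q) * uz q = 0" if "q \<in> D' - D \<inter> u -` {a..}" for q
    using that DD F0[of "u q"] \<phi>0[of "u q"] by auto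
  note Q_glue = plane_C1_on_glue[OF QS \<open>open D'\<close> closed_Z' ZS' outQ]

  have supp: "fst q \<in> {1 / 2..5 / 2} \<and> snd q \<in> {- 1..1}" if "q \<in> D'" for q
    using that \<delta> by (auto simp: D_eq)
  \<comment> \<open>At the centre the velocity is set to zero, and the pressure gradient vanishes as
    well because \<open>b < 1\<close>.\<close>
  have Q_off: "\<phi> (u q) = 0" if "q \<in> D'" "q \<notin> S" for q
  proof -
    have "u q \<ge> 1" using that by (auto simp: S_def)
    then show ?thesis using \<phi>0[of "u q"] ab by auto
  qed
  \<comment> \<open>By connectedness \<open>u\<close> attains the midpoint of \<open>a\<close> and
    \<open>b\<close>, where the bump and thus the swirl are nonzero.\<close>
  have "connected (u ` D)"
    by (rule connected_continuous_image[OF continuous_on_subset[OF u_cont DV]])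
      (simp add: D_def convex_connected convex_box)
  moreover have "u q1 \<in> u ` D" "1 \<in> u ` D"
    using q1(1) \<open>(3 / 2, 0) \<in> D'\<close> DD center by (auto simp: u_def intro!: image_eqI[of _ _ "(3 / 2, 0)"])
  ultimately have "(a + b) / 2 \<in> u ` D"
    using ab connectedD_interval[of "u ` D" "u q1" 1 "(a + b) / 2"] by auto
  then obtain q2 where q2: "q2 \<in> D" "u q2 = (a + b) / 2" by auto
  have q2S: "q2 \<in> S" using q2 ab ZS by (auto simp: Z_def)
  have eqs: "2 * A q + 2 * fst q * At q = Kz q \<and> - 2 * fst q * A q * Bt q + K q * Bz q = 2 * A q * B q
    \<and> - 2 * fst q * A q * At q + K q * Az q - (A q)\<^sup>2 + (B q)\<^sup>2 = 2 * (\<phi> (u q) * ut q)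
    \<and> - 2 * fst q * A q * Kt q + K q * Kz q = - (\<phi> (u q) * uz q)" if "q \<in> S" for q
  proof -
    have q: "q \<in> V" using that SV by auto
    have fq: "fst q > 0" using S_range[OF that] by simp
    have hw: "w q + Wf (u q) / 2 = h q" by (simp add: defs hs_def)
    have "M q = Wd (u q) + 2 * m q - h q * kf (u q)"
      by (simp add: defs Ms_def ws_def algebra_simps)
    moreover have "fst q = (J q)\<^sup>2 * (Wf (u q) - w q)"
      using ts_g[OF q] by (simp add: defs ts_def)
    moreover have "(xi q)\<^sup>2 = 4 * w q ^ 3 - 3 * w q - u q"
      using fst_square[of "g q"] by (simp add: defs)
    moreover have "C q = 12 * (w q)\<^sup>2 - 3" by (simp add: defs Cw_def)
    moreover have "(sqrt (bf (u q)))\<^sup>2 = bf (u q)"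
      using I(3)[of "u q"] uI that by (intro real_sqrt_pow2) force
    moreover have "A q = \<alpha> (u q) * xi q / fst q" "B q = \<alpha> (u q) * sqrt (bf (u q)) / fst q"
      "At q = (\<alpha>' (u q) * ut q * xi q + \<alpha> (u q) * xt q) / fst q - \<alpha> (u q) * xi q / (fst q)\<^sup>2"
      "Az q = (\<alpha>' (u q) * uz q * xi q + \<alpha> (u q) * xz q) / fst q"
      "Bt q = (\<alpha>' (u q) * ut q * sqrt (bf (u q)) + \<alpha> (u q) * (\<sigma>' (u q) * ut q)) / fst q
        - \<alpha> (u q) * sqrt (bf (u q)) / (fst q)\<^sup>2"
      "Bz q = (\<alpha>' (u q) * uz q * sqrt (bf (u q)) + \<alpha> (u q) * (\<sigma>' (u q) * uz q)) / fst q"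
      by (simp_all add: A_def At_def Az_def B_def Bt_def Bz_def divide_inverse power_inverse)
    moreover have "K q = 2 * \<alpha> (u q) * h q / J q"
      "Kt q = (2 * \<alpha>' (u q) / J q - \<alpha> (u q) * kf (u q) / J q) * ut q * h q
        + 2 * \<alpha> (u q) / J q * (wt q + Wd (u q) * ut q / 2)"
      "Kz q = (2 * \<alpha>' (u q) / J q - \<alpha> (u q) * kf (u q) / J q) * uz q * h q
        + 2 * \<alpha> (u q) / J q * (wz q + Wd (u q) * uz q / 2)"
      unfolding K_def Kt_def Kz_def hw by (simp_all add: \<kappa>'_def J_def)
    moreover have "\<phi> (u q) * ut q = - 4 * (\<alpha> (u q))\<^sup>2 * n q / (J q)\<^sup>2 * ut q"
      "\<phi> (u q) * uz q = - 4 * (\<alpha> (u q))\<^sup>2 * n q / (J q)\<^sup>2 * uz q"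
      by (simp_all add: \<phi>_def n_def J_def)
    moreover have "ut q = h q / (n q * (J q)\<^sup>2)" "uz q = xi q / (n q * J q)"
      "xt q = xi q * M q / (2 * n q * (J q)\<^sup>2)" "xz q = (m q * C q - 1) / (2 * n q * J q)"
      "wt q = (h q * m q - n q) / (n q * (J q)\<^sup>2)" "wz q = xi q * m q / (n q * J q)"
      by (simp_all add: ut_def uz_def xt_def xz_def wt_def wz_def)
    ultimately show ?thesis
      by (intro conjI flow_algebra[OF pos(1,2)[OF q] fq comp _ _ hw[symmetric] _ bf_def])
  qed
  show ?thesis
  proof (rule that[OF A_glue B_glue K_glue Q_glue])
    have "\<alpha> (u q2) > 0" using ab by (intro \<alpha>(4)) (simp_all add: q2(2))
    moreover have "bf (u q2) > 0" using I(3) uI q2S by blast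
    ultimately show "\<exists>q. (if q \<in> S then B q else 0) \<noteq> 0"
      using q2S S_range[OF q2S] by (intro exI[of _ q2]) (simp add: B_def)
    fix q
    show "2 * (if q \<in> S then A q else 0) + 2 * fst q * (if q \<in> S then At q else 0) = (if q \<in> S then Kz q else 0)"
      "- 2 * fst q * (if q \<in> S then A q else 0) * (if q \<in> S then Bt q else 0) +
         (if q \<in> S then K q else 0) * (if q \<in> S then Bz q else 0)
       = 2 * (if q \<in> S then A q else 0) * (if q \<in> S then B q else 0)"
      using eqs[of q] by simp_all
    show "- 2 * fst q * (if q \<in> S then A q else 0) * (if q \<in> S then At q else 0) +
         (if q \<in> S then K q else 0) * (if q \<in> S then Az q else 0) - (if q \<in> S then A q else 0)\<^sup>2 +
         (if q \<in> S then B q else 0)\<^sup>2 = 2 * (if q \<in> D' then \<phi> (u q) * ut q else 0)"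
      "- 2 * fst q * (if q \<in> S then A q else 0) * (if q \<in> S then Kt q else 0) +
         (if q \<in> S then K q else 0) * (if q \<in> S then Kz q else 0) = - (if q \<in> D' then \<phi> (u q) * uz q else 0)"
      using eqs[of q] Q_off[of q] DD by (cases "q \<in> S"; force)+
    assume "fst q \<notin> {1 / 2..5 / 2} \<or> snd q \<notin> {- 1..1}"
    then have "q \<notin> D'" "q \<notin> S" using supp[of q] DD by blast+
    then show "(if q \<in> S then A q else 0) = 0 \<and> (if q \<in> S then B q else 0) = 0 \<and>
         (if q \<in> S then K q else 0) = 0 \<and> (if q \<in> D' then F (u q) else 0) = 0"
      by simp
  qed
qed

subsection \<open>Swirling flows in space\<close>

lemma pd_eqI: "(f has_derivative f') (at x) \<Longrightarrow> pd f i x = f' (axis i 1)"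
  unfolding pd_def using frechet_derivative_at[of f f' x] by simp

lemma pd_const [simp]: "pd (\<lambda>_. c) i = (\<lambda>_. 0)"
  by (rule ext) (rule pd_eqI[OF has_derivative_const])

lemma C1_on_const [simp]: "C1_on S (\<lambda>_. c)"
  by (simp add: C1_on_def)

lemma pd_eq_zero:
  assumes "open S" "x \<in> S" "\<And>y. y \<in> S \<Longrightarrow> f y = 0"
  shows "pd f i x = 0"
proof (rule pd_eqI[of f "\<lambda>_. 0", simplified])
  show "(f has_derivative (\<lambda>_. 0)) (at x)"
    by (rule has_derivative_transform_within_open[OF has_derivative_const[of 0] assms(1,2)]) (use assms in auto)
qed

text \<open>With \<open>r^2\<close> in place of \<open>r\<close> the map is polynomial, so the axis
  causes no singularity.\<close>

definition cyl :: "real \<Rightarrow> real^3 \<Rightarrow> real \<times> real" where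
  "cyl z0 x = ((x $ 1)\<^sup>2 + (x $ 2)\<^sup>2, x $ 3 - z0)"

lemma has_derivative_nth: "((\<lambda>x::real^3. x $ i) has_derivative (\<lambda>h. h $ i)) (at x)"
  by (rule bounded_linear.has_derivative[OF bounded_linear_vec_nth has_derivative_ident])

lemma cyl_derivative:
  "(cyl z0 has_derivative (\<lambda>h. (2 * x $ 1 * h $ 1 + 2 * x $ 2 * h $ 2, h $ 3))) (at x)"
  unfolding cyl_def[abs_def]
  by (rule derivative_eq_intros has_derivative_nth refl)+ (simp add: fun_eq_iff algebra_simps)

lemma continuous_on_cyl [continuous_intros]:
  "continuous_on UNIV f \<Longrightarrow> continuous_on S (\<lambda>x. f (cyl z0 x))"
  by (rule continuous_on_compose2[of UNIV f]) (auto simp: cyl_def intro!: continuous_intros)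

lemma plane_C1_on_cyl:
  assumes "plane_C1_on UNIV f ft fz"
  shows "((\<lambda>x. f (cyl z0 x)) has_derivative
     (\<lambda>h. ft (cyl z0 x) * (2 * x $ 1 * h $ 1 + 2 * x $ 2 * h $ 2) + fz (cyl z0 x) * h $ 3)) (at x)"
proof -
  have "(f has_derivative (\<lambda>h. ft (cyl z0 x) * fst h + fz (cyl z0 x) * snd h)) (at (cyl z0 x))"
    using assms unfolding plane_C1_on_def by blast
  from has_derivative_compose[OF cyl_derivative this] show ?thesis by simp
qed

text \<open>The factors \<open>r\<close> in the radial component \<open>-r A\<close> and the
  azimuthal component \<open>r B\<close> turn into Cartesian coordinates.\<close>

definition swirl :: "(real \<times> real \<Rightarrow> real) \<Rightarrow> (real \<times> real \<Rightarrow> real) \<Rightarrow> (real \<times> real \<Rightarrow> real) \<Rightarrow> real \<Rightarrow> real^3 \<Rightarrow> real^3" where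
  "swirl A B K z0 x = (- A (cyl z0 x) * x $ 1 - B (cyl z0 x) * x $ 2) *\<^sub>R axis 1 1
     + (- A (cyl z0 x) * x $ 2 + B (cyl z0 x) * x $ 1) *\<^sub>R axis 2 1 + K (cyl z0 x) *\<^sub>R axis 3 1"

lemma nth_axis_3 [simp]: "axis i (c::real) $ j = (if i = j then c else 0)"
  by (simp add: axis_def)

context
  fixes A At Az B Bt Bz K Kt Kz Q Qt Qz :: "real \<times> real \<Rightarrow> real"
  assumes A: "plane_C1_on UNIV A At Az" and B: "plane_C1_on UNIV B Bt Bz" and K: "plane_C1_on UNIV K Kt Kz"
    and Q: "plane_C1_on UNIV Q Qt Qz"
begin

lemma swirl_differentiable: "swirl A B K z0 differentiable at x"
  and pd_swirl: "pd (swirl A B K z0) i x = (let q = cyl z0 x; h = axis i 1 :: real^3;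
      dr = 2 * x $ 1 * h $ 1 + 2 * x $ 2 * h $ 2; dz = h $ 3 in
      (- (At q * dr + Az q * dz) * x $ 1 - A q * h $ 1 - (Bt q * dr + Bz q * dz) * x $ 2 - B q * h $ 2) *\<^sub>R axis 1 1
    + (- (At q * dr + Az q * dz) * x $ 2 - A q * h $ 2 + (Bt q * dr + Bz q * dz) * x $ 1 + B q * h $ 1) *\<^sub>R axis 2 1
    + (Kt q * dr + Kz q * dz) *\<^sub>R axis 3 1)"
proof -
  have d: "(swirl A B K z0 has_derivative (\<lambda>h. let q = cyl z0 x;
      dr = 2 * x $ 1 * h $ 1 + 2 * x $ 2 * h $ 2; dz = h $ 3 in
      (- (At q * dr + Az q * dz) * x $ 1 - A q * h $ 1 - (Bt q * dr + Bz q * dz) * x $ 2 - B q * h $ 2) *\<^sub>R axis 1 1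
    + (- (At q * dr + Az q * dz) * x $ 2 - A q * h $ 2 + (Bt q * dr + Bz q * dz) * x $ 1 + B q * h $ 1) *\<^sub>R axis 2 1
    + (Kt q * dr + Kz q * dz) *\<^sub>R axis 3 1)) (at x)"
    unfolding swirl_def[abs_def] Let_def
    by (rule derivative_eq_intros plane_C1_on_cyl[OF A] plane_C1_on_cyl[OF B] plane_C1_on_cyl[OF K]
          has_derivative_nth refl)+
       (simp add: fun_eq_iff algebra_simps)
  show "swirl A B K z0 differentiable at x" using d by (rule differentiableI)
  show "pd (swirl A B K z0) i x = (let q = cyl z0 x; h = axis i 1 :: real^3;
      dr = 2 * x $ 1 * h $ 1 + 2 * x $ 2 * h $ 2; dz = h $ 3 in
      (- (At q * dr + Az q * dz) * x $ 1 - A q * h $ 1 - (Bt q * dr + Bz q * dz) * x $ 2 - B q * h $ 2) *\<^sub>R axis 1 1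
    + (- (At q * dr + Az q * dz) * x $ 2 - A q * h $ 2 + (Bt q * dr + Bz q * dz) * x $ 1 + B q * h $ 1) *\<^sub>R axis 2 1
    + (Kt q * dr + Kz q * dz) *\<^sub>R axis 3 1)"
    using pd_eqI[OF d] by (simp add: Let_def)
qed

lemma C1_on_swirl: "C1_on S (swirl A B K z0)"
  unfolding C1_on_def
proof (intro conjI ballI allI swirl_differentiable)
  fix i
  have c: "continuous_on UNIV At" "continuous_on UNIV Az" "continuous_on UNIV Bt" "continuous_on UNIV Bz"
    "continuous_on UNIV Kt" "continuous_on UNIV Kz"
    using A B K by (simp_all add: plane_C1_on_def)
  note c = c plane_C1_on_continuous[OF A] plane_C1_on_continuous[OF B]
  show "continuous_on S (pd (swirl A B K z0) i)"
    unfolding pd_swirl[abs_def] Let_def by (intro continuous_intros c)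
qed

lemma divg_swirl:
  assumes "\<And>q. 2 * A q + 2 * fst q * At q = Kz q"
  shows "divg (swirl A B K z0) x = 0"
  unfolding divg_def pd_swirl Let_def
  using assms[of "cyl z0 x"] by (simp add: sum_3 cyl_def algebra_simps power2_eq_square)

lemma grad_pressure: "grad (\<lambda>x. p0 + r * Q (cyl z0 x)) x
    = (2 * r * x $ 1 * Qt (cyl z0 x)) *\<^sub>R axis 1 1 + (2 * r * x $ 2 * Qt (cyl z0 x)) *\<^sub>R axis 2 1
      + (r * Qz (cyl z0 x)) *\<^sub>R axis 3 1"
  and C1_on_pressure: "C1_on S (\<lambda>x. p0 + r * Q (cyl z0 x))"
proof -
  have d: "((\<lambda>x. p0 + r * Q (cyl z0 x)) has_derivative (\<lambda>h. r * (Qt (cyl z0 x) * (2 * x $ 1 * h $ 1 + 2 * x $ 2 * h $ 2)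
      + Qz (cyl z0 x) * h $ 3))) (at x)" for x
    by (rule derivative_eq_intros plane_C1_on_cyl[OF Q] refl)+ simp
  have pd: "pd (\<lambda>x. p0 + r * Q (cyl z0 x)) i x = r * (Qt (cyl z0 x) * (2 * x $ 1 * axis i 1 $ 1 + 2 * x $ 2 * axis i 1 $ 2)
      + Qz (cyl z0 x) * axis i 1 $ 3)" for i x
    by (rule pd_eqI[OF d])
  show "grad (\<lambda>x. p0 + r * Q (cyl z0 x)) x
    = (2 * r * x $ 1 * Qt (cyl z0 x)) *\<^sub>R axis 1 1 + (2 * r * x $ 2 * Qt (cyl z0 x)) *\<^sub>R axis 2 1
      + (r * Qz (cyl z0 x)) *\<^sub>R axis 3 1"
    by (simp add: vec_eq_iff grad_def pd forall_3)
  show "C1_on S (\<lambda>x. p0 + r * Q (cyl z0 x))"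
    unfolding C1_on_def
  proof (intro conjI ballI allI)
    show "(\<lambda>x. p0 + r * Q (cyl z0 x)) differentiable at x" for x using d by (rule differentiableI)
    show "continuous_on S (pd (\<lambda>x. p0 + r * Q (cyl z0 x)) i)" for i
      unfolding pd[abs_def] using Q by (intro continuous_intros) (auto simp: plane_C1_on_def)
  qed
qed

text \<open>The first two Cartesian components are the radial and azimuthal equations rotated by the
  polar angle; the third is the axial one.\<close>

lemma euler_swirl:
  assumes 2: "\<And>q. - 2 * fst q * A q * Bt q + K q * Bz q = 2 * A q * B q"
    and 3: "\<And>q. - 2 * fst q * A q * At q + K q * Az q - (A q)\<^sup>2 + (B q)\<^sup>2 = 2 * Qt q"
    and 4: "\<And>q. - 2 * fst q * A q * Kt q + K q * Kz q = - Qz q"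
    and "r > 0"
  shows "conv (swirl A B K z0) (swirl A B K z0) x = - (1 / r) *\<^sub>R grad (\<lambda>x. p0 + r * Q (cyl z0 x)) x"
proof -
  define q where "q = cyl z0 x"
  have t: "fst q = (x $ 1)\<^sup>2 + (x $ 2)\<^sup>2" by (simp add: q_def cyl_def)
  note e = 2[of q] 3[of q] 4[of q]
  have "conv (swirl A B K z0) (swirl A B K z0) x $ 1
    = x $ 1 * - (- 2 * fst q * A q * At q + K q * Az q - (A q)\<^sup>2 + (B q)\<^sup>2)
      + x $ 2 * (2 * A q * B q - (- 2 * fst q * A q * Bt q + K q * Bz q))"
    unfolding conv_def pd_swirl Let_def swirl_def q_def[symmetric] t
    by (simp add: sum_3) (simp add: algebra_simps power2_eq_square)
  moreover have "conv (swirl A B K z0) (swirl A B K z0) x $ 2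
    = x $ 2 * - (- 2 * fst q * A q * At q + K q * Az q - (A q)\<^sup>2 + (B q)\<^sup>2)
      - x $ 1 * (2 * A q * B q - (- 2 * fst q * A q * Bt q + K q * Bz q))"
    unfolding conv_def pd_swirl Let_def swirl_def q_def[symmetric] t
    by (simp add: sum_3) (simp add: algebra_simps power2_eq_square)
  moreover have "conv (swirl A B K z0) (swirl A B K z0) x $ 3 = - 2 * fst q * A q * Kt q + K q * Kz q"
    unfolding conv_def pd_swirl Let_def swirl_def q_def[symmetric] t
    by (simp add: sum_3) (simp add: algebra_simps power2_eq_square)
  ultimately show ?thesis
    unfolding e grad_pressure q_def[symmetric] using \<open>r > 0\<close>
    by (simp add: vec_eq_iff forall_3)
qed

end

section \<open>The resting gas bubble and the assembly of the solution\<close>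

text \<open>Pressure times volume of the bubble is a cubic in \<open>R\<close> that vanishes at 0,
  so the intermediate value theorem applies.\<close>

lemma bubble_radius:
  fixes p s m :: real
  assumes "p > 0" "s > 0" "m > 0"
  obtains R where "R > 0" "(p + s * (2 / R)) * (4 / 3 * R ^ 3 * pi) = m"
proof -
  define G where "G = (\<lambda>R. (p * R ^ 3 + 2 * s * R\<^sup>2) * (4 / 3 * pi))"
  \<comment> \<open>Chosen so that \<open>b \<ge> 1\<close> and \<open>p * b \<ge> m\<close>; then
    \<open>p * b ^ 3 \<ge> m\<close>, and \<open>4 / 3 * pi \<ge> 1\<close> does the rest.\<close>
  define b where "b = 1 + m / p"
  have b: "b \<ge> 1" "p * b \<ge> m" using assms by (auto simp: b_def field_simps)
  have "m \<le> p * b ^ 3 * 1"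
  proof -
    have "b \<le> b ^ 3" using b(1) self_le_power[of b 3] by simp
    then have "p * b \<le> p * b ^ 3" using assms by simp
    then show ?thesis using b by simp
  qed
  also have "\<dots> \<le> (p * b ^ 3 + 2 * s * b\<^sup>2) * (4 / 3 * pi)"
    using assms b pi_gt3 by (intro mult_mono) auto
  finally have "m \<le> G b" by (simp add: G_def)
  moreover have "continuous_on {0..b} G" unfolding G_def by (intro continuous_intros)
  moreover have "G 0 = 0" by (simp add: G_def)
  ultimately obtain R where R: "0 \<le> R" "G R = m"
    using IVT'[of G 0 m b] assms b by auto
  then have "R > 0" using \<open>G 0 = 0\<close> assms by (cases "R = 0") auto
  moreover have "(p + s * (2 / R)) * (4 / 3 * R ^ 3 * pi) = G R"
    using \<open>R > 0\<close> by (simp add: G_def field_simps power2_eq_square power3_eq_cube)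
  ultimately show ?thesis using that R by simp
qed


lemma has_integral_const_ball:
  fixes c :: real
  assumes "R \<ge> 0"
  shows "((\<lambda>_. c) has_integral c * (4 / 3 * R ^ 3 * pi)) (ball 0 R :: (real^3) set)"
proof -
  have "((\<lambda>_::real^3. 1::real) has_integral measure lebesgue (ball 0 R :: (real^3) set)) (ball 0 R)"
    using lmeasure_integral[of "ball 0 R :: (real^3) set"] integrable_on_const[of "ball 0 R :: (real^3) set" "1::real"]
    by (simp add: integrable_integral lmeasurable_ball)
  moreover have "measure lebesgue (ball 0 R :: (real^3) set) = 4 / 3 * R ^ 3 * pi"
    using sphere_volume[OF assms, of "0 :: real^3"] by (simp add: measure_completion)
  ultimately have "((\<lambda>_::real^3. 1::real) has_integral 4 / 3 * R ^ 3 * pi) (ball 0 R)"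
    by simp
  then have "((\<lambda>_::real^3. c * 1) has_integral c * (4 / 3 * R ^ 3 * pi)) (ball 0 R)"
    by (rule has_integral_mult_right)
  then show ?thesis by (simp only: mult_1_right)
qed

theorem theorem2p1:
  fixes \<rho>l \<kappa> \<sigma> Tinf pinf Rg cv \<gamma> M :: real
  assumes "\<rho>l > 0" "\<kappa> \<ge> 0" "\<sigma> > 0" "Tinf > 0" "pinf > 0" "Rg > 0" "cv > 0"
    and "\<gamma> = 1 + Rg / cv"
    and "M > 0"
  shows "\<exists>R>0. \<exists>(vl :: real^3 \<Rightarrow> real^3) (pl :: real^3 \<Rightarrow> real)
                    (\<rho>g :: real^3 \<Rightarrow> real) (vg :: real^3 \<Rightarrow> real^3) (pg :: real).
    \<comment> \<open>regularity: classical solution, continuous up to the boundary\<close>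
    C1_on (- cball 0 R) vl \<and> continuous_on (- ball 0 R) vl \<and>
    C1_on (- cball 0 R) pl \<and> continuous_on (- ball 0 R) pl \<and>
    C2_on (ball 0 R) \<rho>g \<and> continuous_on (cball 0 R) \<rho>g \<and>
    C1_on (ball 0 R) vg \<and> continuous_on (cball 0 R) vg \<and>
    (\<forall>x\<in>ball 0 R. \<rho>g x > 0) \<and>
    \<comment> \<open>liquid equations in the exterior\<close>
    (\<forall>x\<in>- cball 0 R. conv vl vl x = - (1 / \<rho>l) *\<^sub>R grad pl x \<and> divg vl x = 0) \<and>
    \<comment> \<open>gas equations in the bubble (pg constant by construction)\<close>
    (\<forall>x\<in>ball 0 R.
        divg (\<lambda>y. \<rho>g y *\<^sub>R vg y) x = 0 \<and>
        0 = \<kappa> / (\<gamma> * cv) * lap (\<lambda>y. ln (\<rho>g y)) x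
            - \<kappa> / (\<gamma> * cv) * (norm (grad \<rho>g x))\<^sup>2 / (\<rho>g x)\<^sup>2
            - vg x \<bullet> grad \<rho>g x) \<and>
    \<comment> \<open>boundary conditions on the sphere: outward normal x/R, surface divergence 2/R\<close>
    (\<forall>x\<in>sphere 0 R.
        vl x \<bullet> ((1 / R) *\<^sub>R x) = 0 \<and> vg x \<bullet> ((1 / R) *\<^sub>R x) = 0 \<and>
        pg - pl x = \<sigma> * (2 / R) \<and>
        pg = Rg * Tinf * \<rho>g x) \<and>
    \<comment> \<open>far-field conditions\<close>
    (\<exists>C r0. \<forall>x. norm x \<ge> r0 \<longrightarrow> norm (vl x) \<le> C / (norm x)\<^sup>2) \<and>
    (\<forall>i. ((pd vl i) \<longlongrightarrow> 0) at_infinity) \<and>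
    (pl \<longlongrightarrow> pinf) at_infinity \<and>
    \<comment> \<open>mass constraint and nontriviality\<close>
    (\<rho>g has_integral M) (ball 0 R) \<and>
    (\<exists>x\<in>- ball 0 R. vl x \<noteq> 0)"
proof -
  obtain A At Az B Bt Bz K Kt Kz Q Qt Qz :: "real \<times> real \<Rightarrow> real" where
    C1: "plane_C1_on UNIV A At Az" "plane_C1_on UNIV B Bt Bz" "plane_C1_on UNIV K Kt Kz" "plane_C1_on UNIV Q Qt Qz"
    and div: "\<And>q. 2 * A q + 2 * fst q * At q = Kz q"
    and euler: "\<And>q. - 2 * fst q * A q * Bt q + K q * Bz q = 2 * A q * B q"
      "\<And>q. - 2 * fst q * A q * At q + K q * Az q - (A q)\<^sup>2 + (B q)\<^sup>2 = 2 * Qt q"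
      "\<And>q. - 2 * fst q * A q * Kt q + K q * Kz q = - Qz q"
    and supp: "\<And>q. fst q \<notin> {1 / 2..5 / 2} \<or> snd q \<notin> {- 1..1} \<Longrightarrow> A q = 0 \<and> B q = 0 \<and> K q = 0 \<and> Q q = 0"
    and nontrivial: "\<exists>q. B q \<noteq> 0"
    by (rule compact_axisymmetric_flow) blast
  have RT: "Rg * Tinf > 0" using assms by simp
  obtain R where R: "R > 0" "(pinf + \<sigma> * (2 / R)) * (4 / 3 * R ^ 3 * pi) = M * (Rg * Tinf)"
    using bubble_radius[of pinf \<sigma> "M * (Rg * Tinf)"] assms RT by (metis mult_pos_pos)
  \<comment> \<open>The flow then lives at heights between \<open>R + 1\<close> and
    \<open>R + 3\<close>, strictly above the bubble.\<close>
  define z0 where "z0 = R + 2"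
  define vl where "vl = swirl A B K z0"
  define pl where "pl = (\<lambda>x. pinf + \<rho>l * Q (cyl z0 x))"
  define pg where "pg = pinf + \<sigma> * (2 / R)"
  define \<rho>0 where "\<rho>0 = pg / (Rg * Tinf)"
  have "pg > 0" using assms R by (simp add: pg_def add_pos_pos)
  then have \<rho>0: "\<rho>0 > 0" "pg = Rg * Tinf * \<rho>0" using RT assms by (simp_all add: \<rho>0_def)
  have off: "vl x = 0 \<and> pl x = pinf" if "fst (cyl z0 x) \<notin> {1 / 2..5 / 2} \<or> snd (cyl z0 x) \<notin> {- 1..1}" for x
    using supp[OF that] by (simp add: vl_def pl_def swirl_def)
  have near: "vl x = 0 \<and> pl x = pinf" if "x \<in> cball 0 R" for x
  proof (rule off)
    have "x $ 3 \<le> R" using that component_le_norm_cart[of x 3] by (auto simp: dist_norm)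
    then show "fst (cyl z0 x) \<notin> {1 / 2..5 / 2} \<or> snd (cyl z0 x) \<notin> {- 1..1}"
      by (simp add: cyl_def z0_def)
  qed
  \<comment> \<open>On the support the first two coordinates are at most 2 and the third at most
    \<open>R + 3\<close> in modulus; their sum bounds the norm.\<close>
  define r0 where "r0 = R + 7"
  have far: "vl x = 0 \<and> pl x = pinf" if "norm x > r0" for x
  proof (rule off, rule ccontr)
    assume "\<not> (fst (cyl z0 x) \<notin> {1 / 2..5 / 2} \<or> snd (cyl z0 x) \<notin> {- 1..1})"
    then have x: "(x $ 1)\<^sup>2 + (x $ 2)\<^sup>2 \<le> 4" "\<bar>x $ 3\<bar> \<le> R + 3"
      using R by (auto simp: cyl_def z0_def)
    have "(x $ 1)\<^sup>2 \<le> 4" "(x $ 2)\<^sup>2 \<le> 4"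
      using x(1) zero_le_power2[of "x $ 1"] zero_le_power2[of "x $ 2"] by linarith+
    then have "\<bar>x $ 1\<bar> \<le> 2" "\<bar>x $ 2\<bar> \<le> 2"
      using abs_le_square_iff[of "x $ 1" 2] abs_le_square_iff[of "x $ 2" 2] by simp_all
    then show False
      using norm_le_l1_cart[of x] x(2) that by (simp add: sum_3 r0_def)
  qed
  show ?thesis
  proof (rule exI[of _ R], rule conjI[OF R(1)], rule exI[of _ vl], rule exI[of _ pl], rule exI[of _ "\<lambda>_. \<rho>0"],
      rule exI[of _ "\<lambda>_. 0"], rule exI[of _ pg], intro conjI ballI)
    show "C1_on (- cball 0 R) vl" "C1_on (- cball 0 R) pl"
      unfolding vl_def pl_def by (rule C1_on_swirl[OF C1] C1_on_pressure[OF C1])+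
    have "C1_on UNIV vl" "C1_on UNIV pl"
      unfolding vl_def pl_def by (rule C1_on_swirl[OF C1] C1_on_pressure[OF C1])+
    then show "continuous_on (- ball 0 R) vl" "continuous_on (- ball 0 R) pl"
      unfolding C1_on_def by (auto intro!: continuous_at_imp_continuous_on differentiable_imp_continuous_within)
    show "C2_on (ball 0 R) (\<lambda>_. \<rho>0)" by (simp add: C2_on_def)
    show "0 = \<kappa> / (\<gamma> * cv) * lap (\<lambda>y. ln \<rho>0) x
            - \<kappa> / (\<gamma> * cv) * (norm (grad (\<lambda>_. \<rho>0) x))\<^sup>2 / \<rho>0\<^sup>2 - 0 \<bullet> grad (\<lambda>_. \<rho>0) x" for x
      by (simp add: lap_def grad_def vec_eq_iff zero_vec_def[symmetric])
    show "conv vl vl x = - (1 / \<rho>l) *\<^sub>R grad pl x" for x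
      unfolding vl_def pl_def by (rule euler_swirl[OF C1 euler assms(1)])
    show "divg vl x = 0" for x unfolding vl_def by (rule divg_swirl[OF C1 div])
    show "\<exists>C r0. \<forall>x. r0 \<le> norm x \<longrightarrow> norm (vl x) \<le> C / (norm x)\<^sup>2"
      using far by (intro exI[of _ 0] exI[of _ "r0 + 1"]) auto
    have out: "open {x :: real^3. norm x > r0}"
      by (intro open_Collect_less continuous_intros)
    show "\<forall>i. (pd vl i \<longlongrightarrow> 0) at_infinity"
    proof
      fix i
      have "pd vl i x = 0" if "norm x > r0" for x
        by (rule pd_eq_zero[OF out]) (use that far in auto)
      then show "(pd vl i \<longlongrightarrow> 0) at_infinity"
        by (intro tendsto_eventually) (auto simp: eventually_at_infinity intro!: exI[of _ "r0 + 1"])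
    qed
    show "(pl \<longlongrightarrow> pinf) at_infinity"
      using far by (intro tendsto_eventually) (auto simp: eventually_at_infinity intro!: exI[of _ "r0 + 1"])
    have "\<rho>0 * (4 / 3 * R ^ 3 * pi) = M"
      using R(2) assms by (simp add: \<rho>0_def pg_def field_simps)
    then show "((\<lambda>_. \<rho>0) has_integral M) (ball 0 R :: (real^3) set)"
      using has_integral_const_ball[of R \<rho>0] R by simp
    obtain q where q: "B q \<noteq> 0" using nontrivial by blast
    then have fq: "fst q > 0" using supp[of q] by force
    \<comment> \<open>A preimage of \<open>q\<close> in the half-plane of polar angle 0, where the
      second velocity component is \<open>sqrt (fst q) * B q\<close>.\<close>
    define x where "x = (vector [sqrt (fst q), 0, snd q + z0] :: real^3)"
    have cx: "cyl z0 x = q" using fq by (simp add: cyl_def x_def)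
    have "vl x $ 2 \<noteq> 0" using q fq cx by (simp add: vl_def swirl_def x_def)
    then have vx: "vl x \<noteq> 0" by auto
    then have "x \<in> - ball 0 R" using near[of x] by auto
    then show "\<exists>x\<in>- ball 0 R. vl x \<noteq> 0" using vx by blast
    show "pg - pl x = \<sigma> * (2 / R)" "vl x \<bullet> ((1 / R) *\<^sub>R x) = 0" if "x \<in> sphere 0 R" for x
      using near[of x] that by (simp_all add: pg_def)
  qed (use R \<rho>0 in \<open>simp_all add: divg_def\<close>)
qed

end
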